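(* Let $M$ be a countable model of $\mathrm{I}\Delta_0+\exp$ and let $n\in\mathbb{N}$. Then $M\models\mathrm{I}\Sigma_{n+2}$ if and only if $M$ admits a proper end extension $K$ with $M\preccurlyeq_{\Sigma_{n+2}}K$ and $K\models M\text{-}\mathrm{I}\Sigma_{n+1}$.
   Context: $\mathrm{I}\Sigma_k$ is the $\Sigma_k$-induction scheme (over $\mathrm{PA}^-$). $M\preccurlyeq_{\Sigma_k}K$: every $\Sigma_k$ formula with parameters from $M$ has the same truth value in $M$ and $K$; end extension: every element of $K\setminus M$ exceeds every element of $M$; proper: $K\neq M$. For an end extension $M\subseteq K$ of models of $\mathrm{I}\Delta_0+\exp$, $K\models M\text{-}\mathrm{I}\Sigma_{n+1}$ means: for every $\Sigma_{n+1}$ formula $\phi(x)$ with parameters from $K$ and every $a\in M$, $K\models\phi(0)\wedge\forall x<a(\phi(x)\to\phi(x+1))\to\forall x<a\,\phi(x)$. *)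

theory Defs
  imports Main "HOL-Library.Countable_Set"
begin

datatype trm = Var nat | Zero | One | Add trm trm | Mul trm trm

datatype fm = Eq trm trm | Lt trm trm | Neg fm | Conj fm fm | Disj fm fm | Impl fm fm
  | Ex nat fm | All nat fm | BEx nat trm fm | BAll nat trm fm

fun tvars :: "trm \<Rightarrow> nat set" where
  "tvars (Var i) = {i}"
| "tvars Zero = {}"
| "tvars One = {}"
| "tvars (Add s t) = tvars s \<union> tvars t"
| "tvars (Mul s t) = tvars s \<union> tvars t"

fun fvars :: "fm \<Rightarrow> nat set" where
  "fvars (Eq s t) = tvars s \<union> tvars t"
| "fvars (Lt s t) = tvars s \<union> tvars t"
| "fvars (Neg p) = fvars p"
| "fvars (Conj p q) = fvars p \<union> fvars q"
| "fvars (Disj p q) = fvars p \<union> fvars q"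
| "fvars (Impl p q) = fvars p \<union> fvars q"
| "fvars (Ex x p) = fvars p - {x}"
| "fvars (All x p) = fvars p - {x}"
| "fvars (BEx x t p) = tvars t \<union> (fvars p - {x})"
| "fvars (BAll x t p) = tvars t \<union> (fvars p - {x})"

fun delta0 :: "fm \<Rightarrow> bool" where
  "delta0 (Eq s t) = True"
| "delta0 (Lt s t) = True"
| "delta0 (Neg p) = delta0 p"
| "delta0 (Conj p q) = (delta0 p \<and> delta0 q)"
| "delta0 (Disj p q) = (delta0 p \<and> delta0 q)"
| "delta0 (Impl p q) = (delta0 p \<and> delta0 q)"
| "delta0 (Ex x p) = False"
| "delta0 (All x p) = False"
| "delta0 (BEx x t p) = (x \<notin> tvars t \<and> delta0 p)"
| "delta0 (BAll x t p) = (x \<notin> tvars t \<and> delta0 p)"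

inductive sigma and pi :: "nat \<Rightarrow> fm \<Rightarrow> bool" where
  sigma0: "delta0 p \<Longrightarrow> sigma 0 p"
| pi0: "delta0 p \<Longrightarrow> pi 0 p"
| sigma_pi: "pi k p \<Longrightarrow> sigma (Suc k) p"
| sigma_ex: "sigma (Suc k) p \<Longrightarrow> sigma (Suc k) (Ex x p)"
| pi_sigma: "sigma k p \<Longrightarrow> pi (Suc k) p"
| pi_all: "pi (Suc k) p \<Longrightarrow> pi (Suc k) (All x p)"

record 'a struc =
  su :: "'a set"
  sz :: 'a
  so :: 'a
  sadd :: "'a \<Rightarrow> 'a \<Rightarrow> 'a"
  smul :: "'a \<Rightarrow> 'a \<Rightarrow> 'a"
  slt :: "'a \<Rightarrow> 'a \<Rightarrow> bool"

fun eval :: "'a struc \<Rightarrow> (nat \<Rightarrow> 'a) \<Rightarrow> trm \<Rightarrow> 'a" where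
  "eval S \<rho> (Var i) = \<rho> i"
| "eval S \<rho> Zero = sz S"
| "eval S \<rho> One = so S"
| "eval S \<rho> (Add s t) = sadd S (eval S \<rho> s) (eval S \<rho> t)"
| "eval S \<rho> (Mul s t) = smul S (eval S \<rho> s) (eval S \<rho> t)"

fun sat :: "'a struc \<Rightarrow> (nat \<Rightarrow> 'a) \<Rightarrow> fm \<Rightarrow> bool" where
  "sat S \<rho> (Eq s t) = (eval S \<rho> s = eval S \<rho> t)"
| "sat S \<rho> (Lt s t) = slt S (eval S \<rho> s) (eval S \<rho> t)"
| "sat S \<rho> (Neg p) = (\<not> sat S \<rho> p)"
| "sat S \<rho> (Conj p q) = (sat S \<rho> p \<and> sat S \<rho> q)"
| "sat S \<rho> (Disj p q) = (sat S \<rho> p \<or> sat S \<rho> q)"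
| "sat S \<rho> (Impl p q) = (sat S \<rho> p \<longrightarrow> sat S \<rho> q)"
| "sat S \<rho> (Ex x p) = (\<exists>v\<in>su S. sat S (\<rho>(x := v)) p)"
| "sat S \<rho> (All x p) = (\<forall>v\<in>su S. sat S (\<rho>(x := v)) p)"
| "sat S \<rho> (BEx x t p) = (\<exists>v\<in>su S. slt S v (eval S \<rho> t) \<and> sat S (\<rho>(x := v)) p)"
| "sat S \<rho> (BAll x t p) = (\<forall>v\<in>su S. slt S v (eval S \<rho> t) \<longrightarrow> sat S (\<rho>(x := v)) p)"

text \<open>PA^- : the theory of nonnegative parts of discretely ordered commutative rings (Kaye).\<close>
definition PAminus :: "'a struc \<Rightarrow> bool" where
  "PAminus S \<longleftrightarrow>
    sz S \<in> su S \<and> so S \<in> su S \<and>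
    (\<forall>x\<in>su S. \<forall>y\<in>su S. sadd S x y \<in> su S \<and> smul S x y \<in> su S) \<and>
    (\<forall>x\<in>su S. \<forall>y\<in>su S. \<forall>w\<in>su S.
       sadd S x (sadd S y w) = sadd S (sadd S x y) w \<and>
       smul S x (smul S y w) = smul S (smul S x y) w \<and>
       smul S x (sadd S y w) = sadd S (smul S x y) (smul S x w) \<and>
       (slt S x y \<and> slt S y w \<longrightarrow> slt S x w) \<and>
       (slt S x y \<longrightarrow> slt S (sadd S x w) (sadd S y w)) \<and>
       (slt S (sz S) w \<and> slt S x y \<longrightarrow> slt S (smul S x w) (smul S y w))) \<and>
    (\<forall>x\<in>su S. \<forall>y\<in>su S.
       sadd S x y = sadd S y x \<and> smul S x y = smul S y x \<and>
       (slt S x y \<or> x = y \<or> slt S y x) \<and>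
       (slt S x y \<longrightarrow> (\<exists>w\<in>su S. sadd S x w = y))) \<and>
    (\<forall>x\<in>su S. sadd S x (sz S) = x \<and> smul S x (sz S) = sz S \<and> smul S x (so S) = x \<and>
       \<not> slt S x x \<and> (slt S (sz S) x \<longrightarrow> (so S = x \<or> slt S (so S) x)) \<and>
       (sz S = x \<or> slt S (sz S) x)) \<and>
    slt S (sz S) (so S)"

definition env_in :: "'a struc \<Rightarrow> (nat \<Rightarrow> 'a) \<Rightarrow> bool" where
  "env_in S \<rho> \<longleftrightarrow> (\<forall>i. \<rho> i \<in> su S)"

definition ISigma :: "nat \<Rightarrow> 'a struc \<Rightarrow> bool" where
  "ISigma k S \<longleftrightarrow> PAminus S \<and>
    (\<forall>p x \<rho>. sigma k p \<longrightarrow> env_in S \<rho> \<longrightarrow>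
       sat S (\<rho>(x := sz S)) p \<longrightarrow>
       (\<forall>v\<in>su S. sat S (\<rho>(x := v)) p \<longrightarrow> sat S (\<rho>(x := sadd S v (so S))) p) \<longrightarrow>
       (\<forall>v\<in>su S. sat S (\<rho>(x := v)) p))"

text \<open>The axiom exp: the (parameter-free) Delta_0-definable exponential function
  x |-> 2^x is total. Variable 0 plays the role of x and variable 1 of y.\<close>
definition exp_ax :: "'a struc \<Rightarrow> bool" where
  "exp_ax S \<longleftrightarrow> (\<exists>E. delta0 E \<and> fvars E \<subseteq> {0, 1} \<and>
     (let R = (\<lambda>x y. sat S ((\<lambda>_. sz S)(0 := x, 1 := y)) E) in
        R (sz S) (so S) \<and>
        (\<forall>x\<in>su S. \<forall>y\<in>su S. R x y \<longrightarrow> R (sadd S x (so S)) (sadd S y y)) \<and>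
        (\<forall>x\<in>su S. \<exists>!y. y \<in> su S \<and> R x y)))"

definition IDelta0_exp :: "'a struc \<Rightarrow> bool" where
  "IDelta0_exp S \<longleftrightarrow> ISigma 0 S \<and> exp_ax S"

definition proper_end_ext :: "'a struc \<Rightarrow> 'b struc \<Rightarrow> ('a \<Rightarrow> 'b) \<Rightarrow> bool" where
  "proper_end_ext M K e \<longleftrightarrow>
    e ` su M \<subseteq> su K \<and> inj_on e (su M) \<and>
    e (sz M) = sz K \<and> e (so M) = so K \<and>
    (\<forall>x\<in>su M. \<forall>y\<in>su M. e (sadd M x y) = sadd K (e x) (e y) \<and>
        e (smul M x y) = smul K (e x) (e y) \<and> (slt M x y \<longleftrightarrow> slt K (e x) (e y))) \<and>
    (\<forall>k\<in>su K - e ` su M. \<forall>m\<in>su M. slt K (e m) k) \<and>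
    e ` su M \<noteq> su K"

definition sigma_elem :: "nat \<Rightarrow> 'a struc \<Rightarrow> 'b struc \<Rightarrow> ('a \<Rightarrow> 'b) \<Rightarrow> bool" where
  "sigma_elem k M K e \<longleftrightarrow>
    (\<forall>p \<rho>. sigma k p \<longrightarrow> env_in M \<rho> \<longrightarrow> (sat M \<rho> p \<longleftrightarrow> sat K (e \<circ> \<rho>) p))"

definition M_ISigma :: "nat \<Rightarrow> 'a struc \<Rightarrow> 'b struc \<Rightarrow> ('a \<Rightarrow> 'b) \<Rightarrow> bool" where
  "M_ISigma k M K e \<longleftrightarrow>
    (\<forall>p x \<rho> a. sigma k p \<longrightarrow> env_in K \<rho> \<longrightarrow> a \<in> su M \<longrightarrow>
       sat K (\<rho>(x := sz K)) p \<longrightarrow>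
       (\<forall>v\<in>su K. slt K v (e a) \<longrightarrow> sat K (\<rho>(x := v)) p \<longrightarrow> sat K (\<rho>(x := sadd K v (so K))) p) \<longrightarrow>
       (\<forall>v\<in>su K. slt K v (e a) \<longrightarrow> sat K (\<rho>(x := v)) p))"

definition good_ext :: "nat \<Rightarrow> 'a struc \<Rightarrow> 'b struc \<Rightarrow> ('a \<Rightarrow> 'b) \<Rightarrow> bool" where
  "good_ext n M K e \<longleftrightarrow> IDelta0_exp K \<and> proper_end_ext M K e \<and>
     sigma_elem (n + 2) M K e \<and> M_ISigma (n + 1) M K e"

end

(*
  Given an end extension K, choose d in K above M. Collection in M is immediate from
  elementarity: d bounds all witnesses in K, so a bound exists in M. Hence the negation of a
  Sigma_{n+2} formula p can be written in M as "for all u, r u" with r in Sigma_{n+1} and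
  decreasing in u, and then p fails at an element of M if and only if r d holds in K.
  Induction for p below an element of M thus becomes Sigma_{n+1} induction in K.

  Conversely, force with Sigma_{n+1} conditions on finitely many Henkin constants that allow
  the first constant to be arbitrarily large. For a family of conditions indexed by c, the
  statement "the c-th condition is large" is Pi_{n+2}, so induction in M yields a least or
  greatest such c. Least values show that a constant bounded by an element of M can be
  decided to be an element of M, hence that the limit model K is an end extension. The
  greatest c below a for which "phi(v) for all v < c" can be forced provides the instance of
  Sigma_{n+1} induction for phi below a in K. As Sigma_{n+1} formulas can be decided and
  witnessed, truth in K is forcing for them, and Pi_{n+2} truths of M remain true in K.
*)
theory Submission
  imports Defs
begin

section \<open>Substitution and negation\<close>

text \<open>Two obstacles shape the proof. The classes \<open>sigma\<close> and \<open>pi\<close>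
  are strictly prenex, so closure properties hold only up to equivalence, and a bounded quantifier
  of the wrong kind is absorbed only by collection, that is, in M. Such an equivalence need not hold
  in K. From K to M, therefore, only the single implication that is needed is carried over, written
  as a formula of complexity at most Pi_{n+2}. It is forced nevertheless: if the formula is
  incompatible with arbitrarily large values of the first constant, some b in M bounds the
  compatible values, and demanding a value above b refutes the formula. The levels then fit:
  conditions in Sigma_{n+1} make largeness Pi_{n+2}, whose negation is open to I Sigma_{n+2}, and
  deciding Sigma_{n+1} formulas is what M-I Sigma_{n+1} and Sigma_{n+2} elementarity of K
  require.\<close>

lemma finite_tvars [simp]: "finite (tvars t)"
  by (induction t) auto

lemma finite_fvars [simp]: "finite (fvars p)"
  by (induction p) auto

lemma eval_cong: "(\<And>i. i \<in> tvars t \<Longrightarrow> \<rho> i = \<rho>' i) \<Longrightarrow> eval S \<rho> t = eval S \<rho>' t"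
  by (induction t) auto

lemma sat_cong: "(\<And>i. i \<in> fvars p \<Longrightarrow> \<rho> i = \<rho>' i) \<Longrightarrow> sat S \<rho> p = sat S \<rho>' p"
proof (induction p arbitrary: \<rho> \<rho>')
  case (Eq s t)
  have "eval S \<rho> s = eval S \<rho>' s" "eval S \<rho> t = eval S \<rho>' t"
    by (rule eval_cong, use Eq.prems in simp)+
  then show ?case by simp
next
  case (Lt s t)
  have "eval S \<rho> s = eval S \<rho>' s" "eval S \<rho> t = eval S \<rho>' t"
    by (rule eval_cong, use Lt.prems in simp)+
  then show ?case by simp
next
  case (Neg p)
  have "sat S \<rho> p = sat S \<rho>' p" by (rule Neg.IH) (use Neg.prems in simp)
  then show ?case by simp
next
  case (Conj p q)
  have "sat S \<rho> p = sat S \<rho>' p" by (rule Conj.IH(1)) (use Conj.prems in simp)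
  moreover have "sat S \<rho> q = sat S \<rho>' q" by (rule Conj.IH(2)) (use Conj.prems in simp)
  ultimately show ?case by simp
next
  case (Disj p q)
  have "sat S \<rho> p = sat S \<rho>' p" by (rule Disj.IH(1)) (use Disj.prems in simp)
  moreover have "sat S \<rho> q = sat S \<rho>' q" by (rule Disj.IH(2)) (use Disj.prems in simp)
  ultimately show ?case by simp
next
  case (Impl p q)
  have "sat S \<rho> p = sat S \<rho>' p" by (rule Impl.IH(1)) (use Impl.prems in simp)
  moreover have "sat S \<rho> q = sat S \<rho>' q" by (rule Impl.IH(2)) (use Impl.prems in simp)
  ultimately show ?case by simp
next
  case (Ex x p)
  have "sat S (\<rho>(x := v)) p = sat S (\<rho>'(x := v)) p" for v
    by (rule Ex.IH) (use Ex.prems in auto)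
  then show ?case by simp
next
  case (All x p)
  have "sat S (\<rho>(x := v)) p = sat S (\<rho>'(x := v)) p" for v
    by (rule All.IH) (use All.prems in auto)
  then show ?case by simp
next
  case (BEx x t p)
  have "sat S (\<rho>(x := v)) p = sat S (\<rho>'(x := v)) p" for v
    by (rule BEx.IH) (use BEx.prems in auto)
  moreover have "eval S \<rho> t = eval S \<rho>' t"
    by (rule eval_cong) (use BEx.prems in auto)
  ultimately show ?case by simp
next
  case (BAll x t p)
  have "sat S (\<rho>(x := v)) p = sat S (\<rho>'(x := v)) p" for v
    by (rule BAll.IH) (use BAll.prems in auto)
  moreover have "eval S \<rho> t = eval S \<rho>' t"
    by (rule eval_cong) (use BAll.prems in auto)
  ultimately show ?case by simp
qed

lemma eval_fresh [simp]: "z \<notin> tvars t \<Longrightarrow> eval S (\<rho>(z := v)) t = eval S \<rho> t"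
  by (rule eval_cong) auto

lemma sat_fresh [simp]: "z \<notin> fvars p \<Longrightarrow> sat S (\<rho>(z := v)) p = sat S \<rho> p"
  by (rule sat_cong) auto

lemma sat_fresh2 [simp]: "z \<notin> fvars p \<Longrightarrow> sat S (\<rho>(z := v, x := w)) p = sat S (\<rho>(x := w)) p"
  by (rule sat_cong) auto

lemma ex_fresh: "finite (F :: nat set) \<Longrightarrow> \<exists>z. z \<notin> F"
  by (rule ex_new_if_finite[OF infinite_UNIV_nat])

lemma env_in_upd [simp]: "env_in S \<rho> \<Longrightarrow> v \<in> su S \<Longrightarrow> env_in S (\<rho>(x := v))"
  by (simp add: env_in_def)

lemma env_in_D: "env_in S \<rho> \<Longrightarrow> \<rho> i \<in> su S"
  by (simp add: env_in_def)

fun tsub :: "(nat \<Rightarrow> trm) \<Rightarrow> trm \<Rightarrow> trm" where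
  "tsub \<sigma> (Var i) = \<sigma> i"
| "tsub \<sigma> Zero = Zero"
| "tsub \<sigma> One = One"
| "tsub \<sigma> (Add s t) = Add (tsub \<sigma> s) (tsub \<sigma> t)"
| "tsub \<sigma> (Mul s t) = Mul (tsub \<sigma> s) (tsub \<sigma> t)"

lemma eval_tsub: "eval S \<rho> (tsub \<sigma> t) = eval S (\<lambda>i. eval S \<rho> (\<sigma> i)) t"
  by (induction t) auto

definition fresh :: "nat set \<Rightarrow> nat" where
  "fresh F = (SOME z. z \<notin> F)"

lemma fresh: "finite F \<Longrightarrow> fresh F \<notin> F"
  unfolding fresh_def by (rule someI_ex[OF ex_fresh])

definition svars :: "(nat \<Rightarrow> trm) \<Rightarrow> fm \<Rightarrow> nat set" where
  "svars \<sigma> p = (\<Union>i\<in>fvars p. tvars (\<sigma> i))"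

lemma finite_svars [simp]: "finite (svars \<sigma> p)"
  by (simp add: svars_def)

text \<open>Every bound variable is renamed, whether or not capture threatens, so that
  \<open>sat_sub\<close> has no side condition. In the bounded cases the new variable also avoids
  the bound, because \<open>delta0\<close> demands this.\<close>

fun sub :: "(nat \<Rightarrow> trm) \<Rightarrow> fm \<Rightarrow> fm" where
  "sub \<sigma> (Eq s t) = Eq (tsub \<sigma> s) (tsub \<sigma> t)"
| "sub \<sigma> (Lt s t) = Lt (tsub \<sigma> s) (tsub \<sigma> t)"
| "sub \<sigma> (Neg p) = Neg (sub \<sigma> p)"
| "sub \<sigma> (Conj p q) = Conj (sub \<sigma> p) (sub \<sigma> q)"
| "sub \<sigma> (Disj p q) = Disj (sub \<sigma> p) (sub \<sigma> q)"
| "sub \<sigma> (Impl p q) = Impl (sub \<sigma> p) (sub \<sigma> q)"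
| "sub \<sigma> (Ex x p) = (let z = fresh (svars \<sigma> p) in Ex z (sub (\<sigma>(x := Var z)) p))"
| "sub \<sigma> (All x p) = (let z = fresh (svars \<sigma> p) in All z (sub (\<sigma>(x := Var z)) p))"
| "sub \<sigma> (BEx x t p) = (let z = fresh (tvars (tsub \<sigma> t) \<union> svars \<sigma> p)
     in BEx z (tsub \<sigma> t) (sub (\<sigma>(x := Var z)) p))"
| "sub \<sigma> (BAll x t p) = (let z = fresh (tvars (tsub \<sigma> t) \<union> svars \<sigma> p)
     in BAll z (tsub \<sigma> t) (sub (\<sigma>(x := Var z)) p))"

lemma sat_sub_bound:
  assumes "z \<notin> svars \<sigma> p"
  shows "sat S (\<lambda>i. eval S (\<rho>(z := v)) ((\<sigma>(x := Var z)) i)) p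
       = sat S ((\<lambda>i. eval S \<rho> (\<sigma> i))(x := v)) p"
  by (rule sat_cong) (use assms in \<open>auto simp: svars_def intro: eval_cong\<close>)

lemma sat_sub: "sat S \<rho> (sub \<sigma> p) = sat S (\<lambda>i. eval S \<rho> (\<sigma> i)) p"
proof (induction p arbitrary: \<rho> \<sigma>)
  case (Ex x p)
  have "fresh (svars \<sigma> p) \<notin> svars \<sigma> p" by (rule fresh) simp
  then show ?case by (simp add: Let_def Ex.IH sat_sub_bound del: fun_upd_apply)
next
  case (All x p)
  have "fresh (svars \<sigma> p) \<notin> svars \<sigma> p" by (rule fresh) simp
  then show ?case by (simp add: Let_def All.IH sat_sub_bound del: fun_upd_apply)
next
  case (BEx x t p)
  have "fresh (tvars (tsub \<sigma> t) \<union> svars \<sigma> p) \<notin> tvars (tsub \<sigma> t) \<union> svars \<sigma> p"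
    by (rule fresh) simp
  then show ?case by (simp add: Let_def BEx.IH sat_sub_bound eval_tsub del: fun_upd_apply)
next
  case (BAll x t p)
  have "fresh (tvars (tsub \<sigma> t) \<union> svars \<sigma> p) \<notin> tvars (tsub \<sigma> t) \<union> svars \<sigma> p"
    by (rule fresh) simp
  then show ?case by (simp add: Let_def BAll.IH sat_sub_bound eval_tsub del: fun_upd_apply)
qed (auto simp: eval_tsub)

lemma delta0_sub: "delta0 p \<Longrightarrow> delta0 (sub \<sigma> p)"
proof (induction p arbitrary: \<sigma>)
  case (BEx x t p)
  have "fresh (tvars (tsub \<sigma> t) \<union> svars \<sigma> p) \<notin> tvars (tsub \<sigma> t) \<union> svars \<sigma> p"
    by (rule fresh) simp
  with BEx show ?case by (simp add: Let_def)
next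
  case (BAll x t p)
  have "fresh (tvars (tsub \<sigma> t) \<union> svars \<sigma> p) \<notin> tvars (tsub \<sigma> t) \<union> svars \<sigma> p"
    by (rule fresh) simp
  with BAll show ?case by (simp add: Let_def)
qed auto

lemma sigma_0_iff [simp]: "sigma 0 p \<longleftrightarrow> delta0 p"
  by (auto intro: sigma0 elim: sigma.cases)

lemma pi_0_iff [simp]: "pi 0 p \<longleftrightarrow> delta0 p"
  by (auto intro: pi0 elim: pi.cases)

text \<open>A one-sided form of the mutual induction: only the outer existential block is unwound,
  and the Pi_k matrix is the base case. The index is decoupled as \<open>j = Suc k\<close> because
  the mutual rule varies it.\<close>

lemma sigma_Suc_induct [consumes 1, case_names base ex]:
  assumes "sigma (Suc k) p"
    and "\<And>q. pi k q \<Longrightarrow> P q"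
    and "\<And>x q. sigma (Suc k) q \<Longrightarrow> P q \<Longrightarrow> P (Ex x q)"
  shows "P p"
proof -
  have "(sigma j p \<longrightarrow> (\<forall>k. j = Suc k \<longrightarrow> (\<forall>q. pi k q \<longrightarrow> P q) \<longrightarrow>
           (\<forall>x q. sigma (Suc k) q \<longrightarrow> P q \<longrightarrow> P (Ex x q)) \<longrightarrow> P p)) \<and> (pi j p \<longrightarrow> True)" for j
    by (rule sigma_pi.induct) auto
  with assms show ?thesis by blast
qed

lemma pi_Suc_induct [consumes 1, case_names base all]:
  assumes "pi (Suc k) p"
    and "\<And>q. sigma k q \<Longrightarrow> P q"
    and "\<And>x q. pi (Suc k) q \<Longrightarrow> P q \<Longrightarrow> P (All x q)"
  shows "P p"
proof -
  have "(sigma j p \<longrightarrow> True) \<and> (pi j p \<longrightarrow> (\<forall>k. j = Suc k \<longrightarrow> (\<forall>q. sigma k q \<longrightarrow> P q) \<longrightarrow>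
           (\<forall>x q. pi (Suc k) q \<longrightarrow> P q \<longrightarrow> P (All x q)) \<longrightarrow> P p))" for j
    by (rule sigma_pi.induct) auto
  with assms show ?thesis by blast
qed

lemma sigma_pi_sub:
  "(sigma k p \<longrightarrow> (\<forall>\<sigma>. sigma k (sub \<sigma> p))) \<and> (pi k p \<longrightarrow> (\<forall>\<sigma>. pi k (sub \<sigma> p)))"
  by (rule sigma_pi.induct) (auto simp: Let_def delta0_sub intro: sigma_pi.intros)

lemma sigma_sub: "sigma k p \<Longrightarrow> sigma k (sub \<sigma> p)"
  and pi_sub: "pi k p \<Longrightarrow> pi k (sub \<sigma> p)"
  using sigma_pi_sub by blast+

lemma sigma_pi_Suc:
  "(sigma k p \<longrightarrow> sigma (Suc k) p) \<and> (pi k p \<longrightarrow> pi (Suc k) p)"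
proof (induction k arbitrary: p)
  case 0
  then show ?case by (auto intro: sigma_pi.intros)
next
  case (Suc k)
  have "sigma (Suc k) p \<Longrightarrow> sigma (Suc (Suc k)) p"
    by (induction rule: sigma_Suc_induct) (use Suc in \<open>auto intro: sigma_pi.intros\<close>)
  moreover have "pi (Suc k) p \<Longrightarrow> pi (Suc (Suc k)) p"
    by (induction rule: pi_Suc_induct) (use Suc in \<open>auto intro: sigma_pi.intros\<close>)
  ultimately show ?case by blast
qed

lemma sigma_mono: "j \<le> k \<Longrightarrow> sigma j p \<Longrightarrow> sigma k p"
  and pi_mono: "j \<le> k \<Longrightarrow> pi j p \<Longrightarrow> pi k p"
  by (induction rule: dec_induct; use sigma_pi_Suc in blast)+

text \<open>\<open>Neg\<close> in front of an unbounded quantifier leaves every class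
  \<open>sigma k\<close> and \<open>pi k\<close>, so negation is pushed inward through the
  prefix.\<close>

fun ng :: "fm \<Rightarrow> fm" where
  "ng (Ex x p) = All x (ng p)"
| "ng (All x p) = Ex x (ng p)"
| "ng p = Neg p"

lemma sat_ng [simp]: "sat S \<rho> (ng p) = (\<not> sat S \<rho> p)"
  by (induction p arbitrary: \<rho>) auto

lemma delta0_ng: "delta0 p \<Longrightarrow> delta0 (ng p)"
  by (cases p) auto

lemma sigma_pi_ng:
  "(sigma k p \<longrightarrow> pi k (ng p)) \<and> (pi k p \<longrightarrow> sigma k (ng p))"
  by (rule sigma_pi.induct) (auto simp: delta0_ng intro: sigma_pi.intros)

lemma sigma_ng: "sigma k p \<Longrightarrow> pi k (ng p)"
  and pi_ng: "pi k p \<Longrightarrow> sigma k (ng p)"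
  using sigma_pi_ng by blast+

section \<open>Formulas up to equivalence\<close>

text \<open>Two families of structures are needed because a prenex form used to transfer truth along
  an extension must be one and the same formula for both universe types.\<close>

definition eqv1 :: "'a struc \<Rightarrow> fm \<Rightarrow> fm \<Rightarrow> bool" where
  "eqv1 S p q \<longleftrightarrow> (\<forall>\<rho>. env_in S \<rho> \<longrightarrow> sat S \<rho> p = sat S \<rho> q)"

definition eqv :: "'a struc set \<Rightarrow> 'b struc set \<Rightarrow> fm \<Rightarrow> fm \<Rightarrow> bool" where
  "eqv A B p q \<longleftrightarrow> (\<forall>S\<in>A. eqv1 S p q) \<and> (\<forall>S\<in>B. eqv1 S p q)"

definition Sg :: "'a struc set \<Rightarrow> 'b struc set \<Rightarrow> nat \<Rightarrow> fm \<Rightarrow> bool" where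
  "Sg A B k p \<longleftrightarrow> (\<exists>q. sigma k q \<and> eqv A B p q)"

definition Pg :: "'a struc set \<Rightarrow> 'b struc set \<Rightarrow> nat \<Rightarrow> fm \<Rightarrow> bool" where
  "Pg A B k p \<longleftrightarrow> (\<exists>q. pi k q \<and> eqv A B p q)"

lemma eqv_refl [simp]: "eqv A B p p"
  by (simp add: eqv_def eqv1_def)

lemma eqv_sym: "eqv A B p q \<Longrightarrow> eqv A B q p"
  by (simp add: eqv_def eqv1_def)

lemma eqv_trans: "eqv A B p q \<Longrightarrow> eqv A B q r \<Longrightarrow> eqv A B p r"
  by (simp add: eqv_def eqv1_def)

lemma eqv_congs:
  "eqv A B p p' \<Longrightarrow> eqv A B (Neg p) (Neg p')"
  "eqv A B p p' \<Longrightarrow> eqv A B q q' \<Longrightarrow> eqv A B (Conj p q) (Conj p' q')"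
  "eqv A B p p' \<Longrightarrow> eqv A B q q' \<Longrightarrow> eqv A B (Disj p q) (Disj p' q')"
  "eqv A B p p' \<Longrightarrow> eqv A B (Ex x p) (Ex x p')"
  "eqv A B p p' \<Longrightarrow> eqv A B (All x p) (All x p')"
  "eqv A B p p' \<Longrightarrow> eqv A B (BEx x t p) (BEx x t p')"
  "eqv A B p p' \<Longrightarrow> eqv A B (BAll x t p) (BAll x t p')"
  by (auto simp: eqv_def eqv1_def)

lemma Sg_eqv: "Sg A B k p \<Longrightarrow> eqv A B p q \<Longrightarrow> Sg A B k q"
  unfolding Sg_def by (meson eqv_sym eqv_trans)

lemma Pg_eqv: "Pg A B k p \<Longrightarrow> eqv A B p q \<Longrightarrow> Pg A B k q"
  unfolding Pg_def by (meson eqv_sym eqv_trans)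

lemma Sg_sigma: "sigma k p \<Longrightarrow> Sg A B k p"
  and Pg_pi: "pi k p \<Longrightarrow> Pg A B k p"
  unfolding Sg_def Pg_def using eqv_refl by blast+

lemma Sg_delta0: "delta0 p \<Longrightarrow> Sg A B k p"
  and Pg_delta0: "delta0 p \<Longrightarrow> Pg A B k p"
  by (meson Sg_sigma Pg_pi sigma_mono pi_mono sigma0 pi0 le0)+

lemma Sg_mono: "j \<le> k \<Longrightarrow> Sg A B j p \<Longrightarrow> Sg A B k p"
  and Pg_mono: "j \<le> k \<Longrightarrow> Pg A B j p \<Longrightarrow> Pg A B k p"
  unfolding Sg_def Pg_def using sigma_mono pi_mono by blast+

lemma Sg_Pg: "j < k \<Longrightarrow> Pg A B j p \<Longrightarrow> Sg A B k p"
  and Pg_Sg: "j < k \<Longrightarrow> Sg A B j p \<Longrightarrow> Pg A B k p"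
  unfolding Sg_def Pg_def
  by (meson sigma_mono pi_mono sigma_pi pi_sigma Suc_leI)+

lemma Sg_Neg: "Pg A B k p \<Longrightarrow> Sg A B k (Neg p)"
  and Pg_Neg: "Sg A B k p \<Longrightarrow> Pg A B k (Neg p)"
proof -
  assume "Pg A B k p"
  then obtain q where "pi k q" "eqv A B p q" unfolding Pg_def by blast
  then have "sigma k (ng q)" "eqv A B (Neg p) (ng q)"
    by (auto simp: pi_ng eqv_def eqv1_def)
  then show "Sg A B k (Neg p)" unfolding Sg_def by blast
next
  assume "Sg A B k p"
  then obtain q where "sigma k q" "eqv A B p q" unfolding Sg_def by blast
  then have "pi k (ng q)" "eqv A B (Neg p) (ng q)"
    by (auto simp: sigma_ng eqv_def eqv1_def)
  then show "Pg A B k (Neg p)" unfolding Pg_def by blast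
qed

lemma Sg_Ex: "0 < k \<Longrightarrow> Sg A B k p \<Longrightarrow> Sg A B k (Ex x p)"
  unfolding Sg_def by (metis Suc_pred' eqv_congs(4) sigma_ex)

lemma Pg_All: "0 < k \<Longrightarrow> Pg A B k p \<Longrightarrow> Pg A B k (All x p)"
  unfolding Pg_def by (metis Suc_pred' eqv_congs(5) pi_all)

lemma Sg_sub: "Sg A B k p \<Longrightarrow> (\<And>S \<rho>. S \<in> A \<Longrightarrow> env_in S \<rho> \<Longrightarrow> env_in S (\<lambda>i. eval S \<rho> (\<sigma> i)))
    \<Longrightarrow> (\<And>S \<rho>. S \<in> B \<Longrightarrow> env_in S \<rho> \<Longrightarrow> env_in S (\<lambda>i. eval S \<rho> (\<sigma> i)))
    \<Longrightarrow> Sg A B k (sub \<sigma> p)"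
  unfolding Sg_def eqv_def eqv1_def by (metis sat_sub sigma_sub)

text \<open>The two connectives are treated together because they are dual: passing through a
  negation, the induction in \<open>Sg_bop\<close> uses the other one at the level below.\<close>

definition bop :: "bool \<Rightarrow> fm \<Rightarrow> fm \<Rightarrow> fm" where
  "bop b p q = (if b then Conj p q else Disj p q)"

lemma sat_bop: "sat S \<rho> (bop b p q) =
    (if b then sat S \<rho> p \<and> sat S \<rho> q else sat S \<rho> p \<or> sat S \<rho> q)"
  by (simp add: bop_def)

lemma eqv_bop: "eqv A B p p' \<Longrightarrow> eqv A B q q' \<Longrightarrow> eqv A B (bop b p q) (bop b p' q')"
  by (simp add: bop_def eqv_congs)

lemma eqv1_bop_pull:
  assumes "z \<notin> fvars p" "z \<notin> svars \<tau> q"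
  shows "eqv1 S (bop b p (sub \<tau> (Ex y q))) (Ex z (bop b p (sub (\<tau>(y := Var z)) q)))"
  unfolding eqv1_def
proof (intro allI impI)
  fix \<rho> assume "env_in S \<rho>"
  \<comment> \<open>For a disjunction the quantifier can be pulled out only over a nonempty
    universe; an assignment into \<open>S\<close> supplies an element.\<close>
  then have "su S \<noteq> {}" by (auto simp: env_in_def)
  then show "sat S \<rho> (bop b p (sub \<tau> (Ex y q)))
      = sat S \<rho> (Ex z (bop b p (sub (\<tau>(y := Var z)) q)))"
    using assms sat_sub_bound[OF assms(2), of S \<rho>]
    by (auto simp: sat_bop sat_sub simp del: sub.simps fun_upd_apply)
qed

lemma eqv_bop_comm: "eqv A B (bop b p q) (bop b q p)"
  by (auto simp: eqv_def eqv1_def sat_bop)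

lemma bop_pull:
  assumes "z \<notin> fvars p" "z \<notin> svars \<tau> q"
  shows "eqv A B (bop b p (sub \<tau> (Ex y q))) (Ex z (bop b p (sub (\<tau>(y := Var z)) q)))"
    and "eqv A B (bop b (sub \<tau> (Ex y q)) p) (Ex z (bop b (sub (\<tau>(y := Var z)) q) p))"
proof -
  show *: "eqv A B (bop b p (sub \<tau> (Ex y q))) (Ex z (bop b p (sub (\<tau>(y := Var z)) q)))"
    by (simp add: eqv_def eqv1_bop_pull assms del: sub.simps)
  then show "eqv A B (bop b (sub \<tau> (Ex y q)) p) (Ex z (bop b (sub (\<tau>(y := Var z)) q) p))"
    by (meson eqv_bop_comm eqv_congs(4) eqv_trans)
qed

lemma eqv_sub_Var [simp]: "eqv A B (sub Var p) p"
  by (simp add: eqv_def eqv1_def sat_sub)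

text \<open>Quantifiers are pulled out one at a time, from \<open>q\<close> when the other side is
  Pi_k, then from \<open>p\<close>. The inductions carry an arbitrary substitution, since renaming
  the pulled variable replaces the remaining formula by a substitution instance.\<close>

lemma Sg_bop: "Sg A B k p \<Longrightarrow> Sg A B k q \<Longrightarrow> Sg A B k (bop b p q)"
proof (induction k arbitrary: p q b)
  case 0
  then obtain p' q' where "delta0 p'" "delta0 q'" "eqv A B p p'" "eqv A B q q'"
    unfolding Sg_def by auto
  then have "delta0 (bop b p' q')" "eqv A B (bop b p q) (bop b p' q')"
    by (auto intro: eqv_bop) (simp add: bop_def)
  then show ?case unfolding Sg_def by (meson sigma0)
next
  case (Suc k)
  have Pg: "Pg A B k (bop b p q)" if "Pg A B k p" "Pg A B k q" for p q b
  proof -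
    have "Pg A B k (Neg (bop (\<not> b) (Neg p) (Neg q)))"
      by (intro Pg_Neg Suc.IH Sg_Neg that)
    then show ?thesis
      by (rule Pg_eqv) (simp add: eqv_def eqv1_def sat_bop)
  qed
  have 1: "Sg A B (Suc k) (bop b p (sub \<tau> q))" if "sigma (Suc k) q" "pi k p" for \<tau> p q
    using that
  proof (induction arbitrary: \<tau> rule: sigma_Suc_induct)
    case (base q)
    then have "Pg A B k (bop b p (sub \<tau> q))" by (intro Pg Pg_pi pi_sub)
    then show ?case by (rule Sg_Pg[rotated]) simp
  next
    case (ex y q)
    obtain z where z: "z \<notin> fvars p \<union> svars \<tau> q" using ex_fresh[of "fvars p \<union> svars \<tau> q"] by auto
    have "Sg A B (Suc k) (Ex z (bop b p (sub (\<tau>(y := Var z)) q)))"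
      by (rule Sg_Ex) (use ex in auto)
    then show ?case
      by (rule Sg_eqv[OF _ eqv_sym[OF bop_pull(1)]]) (use z in auto)
  qed
  have 2: "Sg A B (Suc k) (bop b (sub \<tau> p) q)" if "sigma (Suc k) p" "sigma (Suc k) q" for \<tau> p q
    using that
  proof (induction arbitrary: \<tau> rule: sigma_Suc_induct)
    case (base p)
    have "Sg A B (Suc k) (bop b (sub \<tau> p) (sub Var q))"
      by (rule 1) (use base in \<open>auto intro: pi_sub\<close>)
    then show ?case by (rule Sg_eqv) (intro eqv_bop, auto)
  next
    case (ex y p)
    obtain z where z: "z \<notin> fvars q \<union> svars \<tau> p" using ex_fresh[of "fvars q \<union> svars \<tau> p"] by auto
    have "Sg A B (Suc k) (Ex z (bop b (sub (\<tau>(y := Var z)) p) q))"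
      by (rule Sg_Ex) (use ex in auto)
    then show ?case
      by (rule Sg_eqv[OF _ eqv_sym[OF bop_pull(2)]]) (use z in auto)
  qed
  obtain p' q' where *: "sigma (Suc k) p'" "sigma (Suc k) q'" "eqv A B p p'" "eqv A B q q'"
    using Suc.prems unfolding Sg_def by auto
  have "Sg A B (Suc k) (bop b (sub Var p') q')" by (rule 2) (use * in auto)
  then show ?case
    by (rule Sg_eqv) (meson * eqv_bop eqv_sub_Var eqv_sym eqv_trans)
qed

lemma Pg_bop: "Pg A B k p \<Longrightarrow> Pg A B k q \<Longrightarrow> Pg A B k (bop b p q)"
proof -
  assume "Pg A B k p" "Pg A B k q"
  then have "Pg A B k (Neg (bop (\<not> b) (Neg p) (Neg q)))"
    by (intro Pg_Neg Sg_bop Sg_Neg)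
  then show ?thesis
    by (rule Pg_eqv) (simp add: eqv_def eqv1_def sat_bop)
qed

lemma Sg_Conj: "Sg A B k p \<Longrightarrow> Sg A B k q \<Longrightarrow> Sg A B k (Conj p q)"
  using Sg_bop[where b = True] by (simp add: bop_def)

lemma Pg_Disj: "Pg A B k p \<Longrightarrow> Pg A B k q \<Longrightarrow> Pg A B k (Disj p q)"
  using Pg_bop[where b = False] by (simp add: bop_def)

lemma Pg_Impl: "Sg A B k p \<Longrightarrow> Pg A B k q \<Longrightarrow> Pg A B k (Impl p q)"
  by (rule Pg_eqv[OF Pg_Disj[OF Pg_Neg]]) (auto simp: eqv_def eqv1_def)

text \<open>In front of Pi_k a bounded universal quantifier is absorbed by logic alone, hence in
  both families. Its counterpart for Sigma_k, \<open>Sg_BAll\<close>, rests on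
  \<open>ball_closed\<close>, which is obtained from collection.\<close>

lemma Pg_BAll:
  assumes "x \<notin> tvars t" "Pg A B k p"
  shows "Pg A B k (BAll x t p)"
proof (cases k)
  case 0
  then obtain q where "delta0 q" "eqv A B p q" using assms unfolding Pg_def by auto
  then have "delta0 (BAll x t q)" "eqv A B (BAll x t q) (BAll x t p)"
    using assms by (auto intro: eqv_sym eqv_congs)
  then show ?thesis by (meson Pg_delta0 Pg_eqv)
next
  case (Suc j)
  have "Pg A B k (All x (Impl (Lt (Var x) t) p))"
    by (intro Pg_All Pg_Impl Sg_delta0 assms) (auto simp: Suc)
  then show ?thesis
    by (rule Pg_eqv) (auto simp: eqv_def eqv1_def assms)
qed

lemma Sg_BEx:
  assumes "x \<notin> tvars t" "Sg A B k p"
  shows "Sg A B k (BEx x t p)"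
proof -
  have "Sg A B k (Neg (BAll x t (Neg p)))"
    by (intro Sg_Neg Pg_BAll Pg_Neg assms)
  then show ?thesis by (rule Sg_eqv) (auto simp: eqv_def eqv1_def)
qed

section \<open>Collection and bounded quantification\<close>

locale pa_minus =
  fixes S :: "'a struc"
  assumes PAminus: "PAminus S"
begin

lemma zero_closed [simp]: "sz S \<in> su S" and one_closed [simp]: "so S \<in> su S"
  and add_closed [simp]: "x \<in> su S \<Longrightarrow> y \<in> su S \<Longrightarrow> sadd S x y \<in> su S"
  and mul_closed [simp]: "x \<in> su S \<Longrightarrow> y \<in> su S \<Longrightarrow> smul S x y \<in> su S"
  using PAminus unfolding PAminus_def by blast+

lemma add_assoc: "x \<in> su S \<Longrightarrow> y \<in> su S \<Longrightarrow> w \<in> su S \<Longrightarrow>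
    sadd S x (sadd S y w) = sadd S (sadd S x y) w"
  and lt_trans: "x \<in> su S \<Longrightarrow> y \<in> su S \<Longrightarrow> w \<in> su S \<Longrightarrow> slt S x y \<Longrightarrow> slt S y w \<Longrightarrow> slt S x w"
  and add_mono: "x \<in> su S \<Longrightarrow> y \<in> su S \<Longrightarrow> w \<in> su S \<Longrightarrow> slt S x y \<Longrightarrow>
    slt S (sadd S x w) (sadd S y w)"
  using PAminus unfolding PAminus_def by blast+

lemma add_commute: "x \<in> su S \<Longrightarrow> y \<in> su S \<Longrightarrow> sadd S x y = sadd S y x"
  and lt_linear: "x \<in> su S \<Longrightarrow> y \<in> su S \<Longrightarrow> slt S x y \<or> x = y \<or> slt S y x"
  and lt_diff: "x \<in> su S \<Longrightarrow> y \<in> su S \<Longrightarrow> slt S x y \<Longrightarrow> \<exists>w\<in>su S. sadd S x w = y"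
  using PAminus unfolding PAminus_def by blast+

lemma add_zero [simp]: "x \<in> su S \<Longrightarrow> sadd S x (sz S) = x"
  and lt_irrefl: "x \<in> su S \<Longrightarrow> \<not> slt S x x"
  and one_le: "x \<in> su S \<Longrightarrow> slt S (sz S) x \<Longrightarrow> so S = x \<or> slt S (so S) x"
  and zero_le: "x \<in> su S \<Longrightarrow> sz S = x \<or> slt S (sz S) x"
  and zero_lt_one: "slt S (sz S) (so S)"
  using PAminus unfolding PAminus_def by blast+

lemma eval_closed: "env_in S \<rho> \<Longrightarrow> eval S \<rho> t \<in> su S"
  by (induction t) (auto simp: env_in_def)

lemma zero_add [simp]: "x \<in> su S \<Longrightarrow> sadd S (sz S) x = x"
  by (metis add_commute add_zero zero_closed)

lemma lt_asym: "x \<in> su S \<Longrightarrow> y \<in> su S \<Longrightarrow> slt S x y \<Longrightarrow> \<not> slt S y x"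
  by (metis lt_trans lt_irrefl)

lemma not_lt_zero: "x \<in> su S \<Longrightarrow> \<not> slt S x (sz S)"
  by (metis lt_asym lt_irrefl zero_le zero_closed)

lemma lt_succ: "x \<in> su S \<Longrightarrow> slt S x (sadd S x (so S))"
  by (metis add_commute add_mono one_closed zero_add zero_closed zero_lt_one)

lemma add_cancel: "x \<in> su S \<Longrightarrow> y \<in> su S \<Longrightarrow> w \<in> su S \<Longrightarrow> sadd S x w = sadd S y w \<Longrightarrow> x = y"
  by (metis add_mono lt_irrefl lt_linear add_closed)

lemma succ_le:
  assumes "x \<in> su S" "y \<in> su S" "slt S x y"
  shows "sadd S x (so S) = y \<or> slt S (sadd S x (so S)) y"
proof -
  obtain w where w: "w \<in> su S" "sadd S x w = y" using lt_diff assms by blast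
  then have "sz S \<noteq> w" using assms lt_irrefl by auto
  then have "so S = w \<or> slt S (so S) w" using w one_le zero_le by blast
  then show ?thesis using w assms by (metis add_commute add_mono one_closed)
qed

lemma lt_succ_iff:
  assumes "x \<in> su S" "y \<in> su S"
  shows "slt S x (sadd S y (so S)) \<longleftrightarrow> slt S x y \<or> x = y"
  using assms by (metis add_closed lt_irrefl lt_linear lt_succ lt_trans one_closed succ_le)

lemma pred_ex:
  assumes "x \<in> su S" "x \<noteq> sz S"
  shows "\<exists>y\<in>su S. x = sadd S y (so S)"
  using assms by (metis add_commute lt_diff one_closed one_le zero_add zero_closed zero_le)

lemma ub_ex:
  assumes "x \<in> su S" "y \<in> su S"
  shows "\<exists>u\<in>su S. slt S x u \<and> slt S y u"
  using assms by (metis add_closed lt_linear lt_succ lt_trans one_closed)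

lemma le_add:
  assumes "x \<in> su S" "y \<in> su S"
  shows "slt S y (sadd S (sadd S x y) (so S))"
  using assms by (metis add_closed add_mono lt_succ_iff zero_add zero_closed zero_le)

end

section \<open>Induction, collection and quantifier contraction in a single structure\<close>

lemma ISigma_pa_minus: "ISigma k S \<Longrightarrow> pa_minus S"
  by (simp add: ISigma_def pa_minus_def)

lemma ISigma_mono: "j \<le> k \<Longrightarrow> ISigma k S \<Longrightarrow> ISigma j S"
  unfolding ISigma_def using sigma_mono by blast

text \<open>For closure properties of one structure the second family is empty; it borrows the
  universe type of the first only to have a definite type.\<close>

abbreviation SgM :: "'a struc \<Rightarrow> nat \<Rightarrow> fm \<Rightarrow> bool" where
  "SgM M \<equiv> Sg {M} ({} :: 'a struc set)"

abbreviation PgM :: "'a struc \<Rightarrow> nat \<Rightarrow> fm \<Rightarrow> bool" where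
  "PgM M \<equiv> Pg {M} ({} :: 'a struc set)"

abbreviation eqvM :: "'a struc \<Rightarrow> fm \<Rightarrow> fm \<Rightarrow> bool" where
  "eqvM M \<equiv> eqv {M} ({} :: 'a struc set)"

lemma eqvM_iff: "eqvM M p q \<longleftrightarrow> (\<forall>\<rho>. env_in M \<rho> \<longrightarrow> sat M \<rho> p = sat M \<rho> q)"
  by (simp add: eqv_def eqv1_def)

lemma ISigma_induct:
  assumes "ISigma k M" "SgM M k p" "env_in M \<rho>" "sat M (\<rho>(x := sz M)) p"
    and "\<And>v. v \<in> su M \<Longrightarrow> sat M (\<rho>(x := v)) p \<Longrightarrow> sat M (\<rho>(x := sadd M v (so M))) p"
    and "v \<in> su M"
  shows "sat M (\<rho>(x := v)) p"
proof -
  interpret pa_minus M using assms(1) by (rule ISigma_pa_minus)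
  obtain q where q: "sigma k q" "\<And>\<rho>. env_in M \<rho> \<Longrightarrow> sat M \<rho> p = sat M \<rho> q"
    using assms(2) unfolding Sg_def eqvM_iff by blast
  then have *: "sat M (\<rho>(x := v)) p = sat M (\<rho>(x := v)) q" if "v \<in> su M" for v
    using assms(3) that by simp
  have ind: "sat M (\<rho>(x := sz M)) q \<Longrightarrow>
      \<forall>v\<in>su M. sat M (\<rho>(x := v)) q \<longrightarrow> sat M (\<rho>(x := sadd M v (so M))) q \<Longrightarrow>
      \<forall>v\<in>su M. sat M (\<rho>(x := v)) q"
    using assms(1,3) q(1) unfolding ISigma_def by blast
  have "\<forall>v\<in>su M. sat M (\<rho>(x := v)) q"
  proof (rule ind)
    show "sat M (\<rho>(x := sz M)) q" using assms(4) *[OF zero_closed] by blast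
    show "\<forall>v\<in>su M. sat M (\<rho>(x := v)) q \<longrightarrow> sat M (\<rho>(x := sadd M v (so M))) q"
    proof (intro ballI impI)
      fix v assume v: "v \<in> su M" "sat M (\<rho>(x := v)) q"
      then have "sat M (\<rho>(x := sadd M v (so M))) p" using assms(5)[of v] *[of v] by metis
      then show "sat M (\<rho>(x := sadd M v (so M))) q" using *[OF add_closed[OF v(1) one_closed]] by metis
    qed
  qed
  then show ?thesis using * assms(6) by blast
qed

definition ball_closed :: "'a struc \<Rightarrow> nat \<Rightarrow> bool" where
  "ball_closed M k \<longleftrightarrow> (\<forall>p x t. sigma k p \<longrightarrow> x \<notin> tvars t \<longrightarrow> SgM M k (BAll x t p))"

text \<open>This is the scheme B Pi_k, over I Delta_0 equivalent to B Sigma_{k+1}.\<close>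

definition collection :: "'a struc \<Rightarrow> nat \<Rightarrow> bool" where
  "collection M k \<longleftrightarrow> (\<forall>p x z \<rho> a. pi k p \<longrightarrow> env_in M \<rho> \<longrightarrow> a \<in> su M \<longrightarrow>
     (\<forall>v\<in>su M. slt M v a \<longrightarrow> (\<exists>w\<in>su M. sat M (\<rho>(x := v, z := w)) p)) \<longrightarrow>
     (\<exists>u\<in>su M. \<forall>v\<in>su M. slt M v a \<longrightarrow> (\<exists>w\<in>su M. slt M w u \<and> sat M (\<rho>(x := v, z := w)) p)))"

lemma ball_closed_0: "ball_closed M 0"
  by (auto simp: ball_closed_def intro: Sg_delta0)

lemma Sg_BAll: "ball_closed M k \<Longrightarrow> SgM M k p \<Longrightarrow> x \<notin> tvars t \<Longrightarrow> SgM M k (BAll x t p)"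
proof -
  assume "ball_closed M k" "SgM M k p" "x \<notin> tvars t"
  then obtain q where "SgM M k (BAll x t q)" "eqvM M p q"
    unfolding ball_closed_def Sg_def[of _ _ _ p] by blast
  then show ?thesis using Sg_eqv eqv_congs(7) eqv_sym by blast
qed

lemma Pg_BEx:
  assumes "ball_closed M k" "PgM M k p" "x \<notin> tvars t"
  shows "PgM M k (BEx x t p)"
proof -
  have "PgM M k (Neg (BAll x t (Neg p)))"
    by (intro Pg_Neg Sg_BAll Sg_Neg assms)
  then show ?thesis by (rule Pg_eqv) (auto simp: eqv_def eqv1_def)
qed

text \<open>A pair of witnesses is replaced by a common upper bound u instead of a code for the
  pair. The two quantifiers, now bounded by u, are absorbed in Pi_k by
  \<open>ball_closed M k\<close>.\<close>

lemma sigma_contract: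
  assumes "sigma (Suc k) p" "ball_closed M k" "pa_minus M" "finite F"
  shows "\<exists>z q. z \<notin> F \<and> pi k q \<and> eqvM M p (Ex z q)"
  using assms(1,4)
proof (induction arbitrary: F rule: sigma_Suc_induct)
  case (base q)
  \<comment> \<open>An empty block receives a dummy quantifier.\<close>
  obtain z where z: "z \<notin> F \<union> fvars q" using ex_fresh[of "F \<union> fvars q"] base by auto
  then have "eqvM M q (Ex z q)"
    by (auto simp: eqvM_iff env_in_def)
  with z base show ?case by blast
next
  case (ex x q)
  interpret pa_minus M by fact
  obtain z r where z: "z \<notin> insert x F" "pi k r" "eqvM M q (Ex z r)"
    using ex.IH[of "insert x F"] ex.prems by auto
  obtain u where u: "u \<notin> F \<union> {x, z} \<union> fvars r"
    using ex_fresh[of "F \<union> {x, z} \<union> fvars r"] ex.prems by auto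
  have "PgM M k (BEx x (Var u) (BEx z (Var u) r))"
    by (intro Pg_BEx assms Pg_pi z) (use u in auto)
  then obtain r' where r': "pi k r'" "eqvM M (BEx x (Var u) (BEx z (Var u) r)) r'"
    unfolding Pg_def by blast
  have "sat M \<rho> (Ex x q) = sat M \<rho> (Ex u r')" if \<rho>: "env_in M \<rho>" for \<rho>
  proof -
    have drop: "sat M (\<rho>(u := c, x := v, z := w)) r = sat M (\<rho>(x := v, z := w)) r" for c v w
      by (rule sat_cong) (use u in auto)
    have "sat M \<rho> (Ex x q) \<longleftrightarrow> (\<exists>v\<in>su M. \<exists>w\<in>su M. sat M (\<rho>(x := v, z := w)) r)"
      using z(3) \<rho> by (simp add: eqvM_iff)
    also have "\<dots> \<longleftrightarrow> (\<exists>c\<in>su M. \<exists>v\<in>su M. slt M v c \<and>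
        (\<exists>w\<in>su M. slt M w c \<and> sat M (\<rho>(x := v, z := w)) r))"
      using ub_ex by blast
    also have "\<dots> \<longleftrightarrow> sat M \<rho> (Ex u (BEx x (Var u) (BEx z (Var u) r)))"
      using u by (simp add: drop)
    also have "\<dots> \<longleftrightarrow> sat M \<rho> (Ex u r')"
      using eqv_congs(4)[OF r'(2)] \<rho> unfolding eqvM_iff by blast
    finally show ?thesis .
  qed
  then show ?case using r' u unfolding eqvM_iff by blast
qed

text \<open>Once the block is contracted to a single witness z, collection bounds all witnesses for
  x < t by one u. The quantifier on u moves to the front, and what remains is Pi_k again.\<close>

lemma ball_closed_Suc:
  assumes "ball_closed M k" "collection M k" "pa_minus M"
  shows "ball_closed M (Suc k)"
  unfolding ball_closed_def
proof (intro allI impI)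
  fix p x t
  assume p: "sigma (Suc k) p" and x: "x \<notin> tvars t"
  interpret pa_minus M by fact
  obtain z q where z: "z \<notin> insert x (tvars t)" "pi k q" "eqvM M p (Ex z q)"
    using sigma_contract[OF p assms(1,3), of "insert x (tvars t)"] by auto
  obtain u where u: "u \<notin> {x, z} \<union> tvars t \<union> fvars q"
    using ex_fresh[of "{x, z} \<union> tvars t \<union> fvars q"] by auto
  have "SgM M (Suc k) (Ex u (BAll x t (BEx z (Var u) q)))"
    by (intro Sg_Ex Sg_Pg[of k "Suc k"] Pg_BAll Pg_BEx Pg_pi assms z x) (use u in auto)
  moreover have "sat M \<rho> (Ex u (BAll x t (BEx z (Var u) q))) = sat M \<rho> (BAll x t p)"
    if \<rho>: "env_in M \<rho>" for \<rho>
  proof -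
    let ?a = "eval M \<rho> t"
    have a: "?a \<in> su M" using \<rho> by (rule eval_closed)
    have drop: "sat M (\<rho>(u := c, x := v, z := w)) q = sat M (\<rho>(x := v, z := w)) q" for c v w
      by (rule sat_cong) (use u in auto)
    have "sat M \<rho> (BAll x t p) \<longleftrightarrow>
        (\<forall>v\<in>su M. slt M v ?a \<longrightarrow> (\<exists>w\<in>su M. sat M (\<rho>(x := v, z := w)) q))"
      using z(3) \<rho> by (simp add: eqvM_iff)
    also have "\<dots> \<longleftrightarrow> (\<exists>c\<in>su M. \<forall>v\<in>su M. slt M v ?a \<longrightarrow>
        (\<exists>w\<in>su M. slt M w c \<and> sat M (\<rho>(x := v, z := w)) q))"
      using assms(2) z(2) \<rho> a unfolding collection_def by blast
    also have "\<dots> \<longleftrightarrow> sat M \<rho> (Ex u (BAll x t (BEx z (Var u) q)))"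
      using u by (simp add: drop)
    finally show ?thesis by simp
  qed
  ultimately show "SgM M (Suc k) (BAll x t p)"
    by (meson Sg_eqv eqvM_iff)
qed

text \<open>Induction on s for the existence of one bound that serves all v below both s and a. The
  cut at a matters because the step has to be valid for every s in M, while witnesses are given only
  below a.\<close>

lemma ISigma_collection:
  assumes "ISigma (Suc k) M" "ball_closed M k"
  shows "collection M k"
  unfolding collection_def
proof (intro allI impI)
  fix p x z \<rho> a
  assume p: "pi k p" and \<rho>: "env_in M \<rho>" and a: "a \<in> su M"
    and H: "\<forall>v\<in>su M. slt M v a \<longrightarrow> (\<exists>w\<in>su M. sat M (\<rho>(x := v, z := w)) p)"
  interpret pa_minus M using assms(1) by (rule ISigma_pa_minus)
  obtain s where s: "s \<notin> {x, z} \<union> fvars p" using ex_fresh[of "{x, z} \<union> fvars p"] by auto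
  obtain c where c: "c \<notin> {x, z, s} \<union> fvars p" using ex_fresh[of "{x, z, s} \<union> fvars p"] by auto
  obtain u where u: "u \<notin> {x, z, s, c} \<union> fvars p" using ex_fresh[of "{x, z, s, c} \<union> fvars p"] by auto
  let ?B = "\<lambda>b. \<exists>d\<in>su M. \<forall>v\<in>su M. slt M v b \<longrightarrow> slt M v a \<longrightarrow>
      (\<exists>w\<in>su M. slt M w d \<and> sat M (\<rho>(x := v, z := w)) p)"
  let ?p = "Ex u (BAll x (Var s) (Impl (Lt (Var x) (Var c)) (BEx z (Var u) p)))"
  have Sg: "SgM M (Suc k) ?p"
    by (intro Sg_Ex Sg_Pg[of k "Suc k"] Pg_BAll Pg_Impl Pg_BEx Pg_pi Sg_delta0 assms p)
      (use s u in auto)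
  have sat: "sat M (\<rho>(c := a, s := b)) ?p \<longleftrightarrow> ?B b" for b
  proof -
    have "sat M (\<rho>(c := a, s := b, u := d, x := v, z := w)) p = sat M (\<rho>(x := v, z := w)) p" for d v w
      by (rule sat_cong) (use s c u in auto)
    then show ?thesis using s c u by simp
  qed
  have B0: "?B (sz M)" using not_lt_zero zero_closed by blast
  have BS: "?B (sadd M b (so M))" if b: "b \<in> su M" and "?B b" for b
  proof -
    from that obtain d where d: "d \<in> su M" "\<forall>v\<in>su M. slt M v b \<longrightarrow> slt M v a \<longrightarrow>
      (\<exists>w\<in>su M. slt M w d \<and> sat M (\<rho>(x := v, z := w)) p)" by blast
    show ?thesis
    proof (cases "slt M b a")
      case True
      then obtain w where w: "w \<in> su M" "sat M (\<rho>(x := b, z := w)) p" using H b by blast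
      obtain d' where d': "d' \<in> su M" "slt M d d'" "slt M w d'" using ub_ex d w by blast
      show ?thesis
      proof (rule bexI[OF _ d'(1)], intro ballI impI)
        fix v assume v: "v \<in> su M" "slt M v (sadd M b (so M))" "slt M v a"
        then consider "slt M v b" | "v = b" using b lt_succ_iff by blast
        then show "\<exists>w\<in>su M. slt M w d' \<and> sat M (\<rho>(x := v, z := w)) p"
        proof cases
          case 1
          then show ?thesis using d v d' by (meson lt_trans)
        next
          case 2
          then show ?thesis using w d' by blast
        qed
      qed
    next
      case False
      then have "slt M v b" if "v \<in> su M" "slt M v (sadd M b (so M))" "slt M v a" for v
        using that b lt_succ_iff by blast
      with d show ?thesis by blast
    qed
  qed
  have "sat M (\<rho>(c := a, s := a)) ?p"
  proof (rule ISigma_induct[OF assms(1) Sg _ _ _ a])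
    show "env_in M (\<rho>(c := a))" using \<rho> a by simp
    show "sat M (\<rho>(c := a, s := sz M)) ?p" using B0 unfolding sat .
    show "sat M (\<rho>(c := a, s := sadd M b (so M))) ?p"
      if "b \<in> su M" "sat M (\<rho>(c := a, s := b)) ?p" for b
      using BS that unfolding sat by blast
  qed
  then show "\<exists>u\<in>su M. \<forall>v\<in>su M. slt M v a \<longrightarrow> (\<exists>w\<in>su M. slt M w u \<and> sat M (\<rho>(x := v, z := w)) p)"
    unfolding sat by blast
qed

text \<open>Closure and collection climb together: closure at level k makes the induction formula of
  \<open>ISigma_collection\<close> Sigma_{k+1}, and collection then yields closure at level k +
  1.\<close>

lemma ISigma_ball_closed: "ISigma k M \<Longrightarrow> ball_closed M k"
proof (induction k)
  case (Suc k)
  have "ISigma k M" by (rule ISigma_mono[OF _ Suc.prems]) simp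
  then show ?case
    using ball_closed_Suc ISigma_collection Suc ISigma_pa_minus by blast
qed (rule ball_closed_0)

section \<open>End extensions yield induction\<close>

locale ext = M: pa_minus M + K: pa_minus K
  for M :: "'a struc" and K :: "'b struc" +
  fixes e :: "'a \<Rightarrow> 'b" and n :: nat
  assumes end_ext: "proper_end_ext M K e"
    and elem: "sigma_elem (n + 2) M K e"
begin

lemma e_closed [simp]: "x \<in> su M \<Longrightarrow> e x \<in> su K"
  and e_inj: "x \<in> su M \<Longrightarrow> y \<in> su M \<Longrightarrow> e x = e y \<Longrightarrow> x = y"
  and e_zero: "e (sz M) = sz K" and e_one: "e (so M) = so K"
  and e_add: "x \<in> su M \<Longrightarrow> y \<in> su M \<Longrightarrow> e (sadd M x y) = sadd K (e x) (e y)"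
  and e_lt: "x \<in> su M \<Longrightarrow> y \<in> su M \<Longrightarrow> slt K (e x) (e y) \<longleftrightarrow> slt M x y"
  using end_ext unfolding proper_end_ext_def inj_on_def by blast+

lemma below_in_M:
  assumes "k \<in> su K" "m \<in> su M" "slt K k (e m)"
  shows "\<exists>x\<in>su M. k = e x \<and> slt M x m"
proof -
  have "k \<in> e ` su M"
    using end_ext assms K.lt_asym[OF assms(1) e_closed[OF assms(2)]]
    unfolding proper_end_ext_def by blast
  then show ?thesis using e_lt assms by auto
qed

lemma above_ex: "\<exists>d\<in>su K. \<forall>m\<in>su M. slt K (e m) d"
  using end_ext unfolding proper_end_ext_def by blast

lemma env_e [simp]: "env_in M \<rho> \<Longrightarrow> env_in K (e \<circ> \<rho>)"
  by (simp add: env_in_def)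

lemma transfer_Sg:
  assumes "Sg {M} {K} (n + 2) p" "env_in M \<rho>"
  shows "sat K (e \<circ> \<rho>) p = sat M \<rho> p"
proof -
  obtain q where "sigma (n + 2) q" "eqv {M} {K} p q" using assms unfolding Sg_def by blast
  with assms(2) env_e[OF assms(2)] elem show ?thesis
    unfolding sigma_elem_def eqv_def eqv1_def by blast
qed

lemma transfer_Pg:
  assumes "Pg {M} {K} (n + 2) p" "env_in M \<rho>"
  shows "sat K (e \<circ> \<rho>) p = sat M \<rho> p"
  using transfer_Sg[OF Sg_Neg[OF assms(1)] assms(2)] by simp

text \<open>An element of \<open>K\<close> above \<open>M\<close> bounds the witnesses, and the existence of a bound is
  reflected back to \<open>M\<close>.\<close>

lemma collection_M:
  assumes "ball_closed M k" "k \<le> n"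
  shows "collection M k"
  unfolding collection_def
proof (intro allI impI)
  fix p x z \<rho> a
  assume p: "pi k p" and \<rho>: "env_in M \<rho>" and a: "a \<in> su M"
    and H: "\<forall>v\<in>su M. slt M v a \<longrightarrow> (\<exists>w\<in>su M. sat M (\<rho>(x := v, z := w)) p)"
  obtain u where u: "u \<notin> {x, z} \<union> fvars p" using ex_fresh[of "{x, z} \<union> fvars p"] by auto
  have "PgM M k (BEx z (Var u) p)"
    by (intro Pg_BEx assms Pg_pi p) (use u in auto)
  then obtain q where q: "pi k q" and "eqvM M (BEx z (Var u) p) q"
    unfolding Pg_def by blast
  then have qM: "sat M \<rho> q = sat M \<rho> (BEx z (Var u) p)" if "env_in M \<rho>" for \<rho>
    using that unfolding eqvM_iff by blast
  obtain c where c: "c \<notin> {x, z, u} \<union> fvars p \<union> fvars q"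
    using ex_fresh[of "{x, z, u} \<union> fvars p \<union> fvars q"] by auto
  obtain d where d: "d \<in> su K" "\<forall>m\<in>su M. slt K (e m) d" using above_ex by blast
  \<comment> \<open>The equivalence of q with the bounded formula is known in M only. The
    implication that K has to satisfy is Pi_{k+1} and can be transferred.\<close>
  let ?p = "All u (Impl (BEx z (Var u) p) q)"
  have "Pg {M} {K} (Suc k) ?p"
    by (intro Pg_All Pg_Impl Sg_BEx Sg_Pg[of k "Suc k"] Pg_mono[of k "Suc k"] Pg_pi q p)
      (use u in auto)
  then have P: "Pg {M} {K} (n + 2) ?p" by (rule Pg_mono[rotated]) (use assms in simp)
  have "Pg {M} {K} (n + 2) p" by (rule Pg_mono[OF _ Pg_pi[OF p]]) (use assms in simp)
  note pK = transfer_Pg[OF this]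
  have "sat K ((e \<circ> \<rho>)(x := e v, u := d)) q" if v: "v \<in> su M" "slt M v a" for v
  proof -
    obtain w where w: "w \<in> su M" "sat M (\<rho>(x := v, z := w)) p" using H v by blast
    have "sat M (\<rho>(x := v)) ?p" using \<rho> v qM by simp
    then have "sat K (e \<circ> \<rho>(x := v)) ?p"
      using transfer_Pg[OF P, of "\<rho>(x := v)"] \<rho> v by simp
    then have *: "sat K ((e \<circ> \<rho>(x := v))(u := d)) (Impl (BEx z (Var u) p) q)"
      using d(1) by (auto simp del: sat.simps(6))
    have "sat K (e \<circ> \<rho>(x := v, z := w)) p" using pK w \<rho> v by simp
    also have "sat K (e \<circ> \<rho>(x := v, z := w)) p = sat K ((e \<circ> \<rho>(x := v))(u := d, z := e w)) p"
      by (rule sat_cong) (use u in auto)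
    finally have "sat K ((e \<circ> \<rho>(x := v))(u := d)) (BEx z (Var u) p)"
      using w d u by auto
    with * have "sat K ((e \<circ> \<rho>(x := v))(u := d)) q" by simp
    then show ?thesis by (simp add: fun_upd_comp)
  qed
  note dq = this
  \<comment> \<open>The bound a is passed through the variable c. In K the quantifier still ranges
    over elements coming from M, whose image is an initial segment.\<close>
  let ?r = "BAll x (Var c) q"
  have "sat K ((e \<circ> \<rho>(c := a))(u := d)) ?r"
  proof -
    have "sat K ((e \<circ> \<rho>(c := a))(u := d, x := v)) q"
      if v: "v \<in> su K" "slt K v (e a)" for v
    proof -
      obtain v0 where v0: "v0 \<in> su M" "v = e v0" "slt M v0 a" using below_in_M v a by blast
      have "sat K ((e \<circ> \<rho>)(x := e v0, u := d)) q" using dq v0 by blast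
      also have "sat K ((e \<circ> \<rho>)(x := e v0, u := d)) q = sat K ((e \<circ> \<rho>(c := a))(u := d, x := v)) q"
        by (rule sat_cong) (use u c v0 in auto)
      finally show ?thesis .
    qed
    then show ?thesis using c by simp
  qed
  then have "sat K (e \<circ> \<rho>(c := a)) (Ex u ?r)"
    unfolding sat.simps(7) using d(1) by blast
  moreover have "Sg {M} {K} (n + 2) (Ex u ?r)"
    by (intro Sg_Ex Sg_Pg[of k] Pg_BAll Pg_pi q) (use c assms in auto)
  ultimately have "sat M (\<rho>(c := a)) (Ex u ?r)"
    using transfer_Sg \<rho> a by (metis env_in_upd)
  then obtain b where b: "b \<in> su M" "sat M (\<rho>(c := a, u := b)) ?r" by auto
  have "\<exists>w\<in>su M. slt M w b \<and> sat M (\<rho>(x := v, z := w)) p" if v: "v \<in> su M" "slt M v a" for v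
  proof -
    have "sat M (\<rho>(c := a, u := b, x := v)) q" using b v c by simp
    then have "sat M (\<rho>(c := a, u := b, x := v)) (BEx z (Var u) p)" using qM \<rho> a b v by simp
    then obtain w where w: "w \<in> su M" "slt M w b" "sat M (\<rho>(c := a, u := b, x := v, z := w)) p"
      using u by auto
    have "sat M (\<rho>(c := a, u := b, x := v, z := w)) p = sat M (\<rho>(x := v, z := w)) p"
      by (rule sat_cong) (use u c in auto)
    then show ?thesis using w by blast
  qed
  then show "\<exists>u\<in>su M. \<forall>v\<in>su M. slt M v a \<longrightarrow> (\<exists>w\<in>su M. slt M w u \<and> sat M (\<rho>(x := v, z := w)) p)"
    using b by blast
qed

lemma ball_closed_M: "k \<le> n + 1 \<Longrightarrow> ball_closed M k"
proof (induction k)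
  case (Suc k)
  then show ?case by (intro ball_closed_Suc collection_M M.pa_minus_axioms) auto
qed (rule ball_closed_0)

text \<open>In \<open>M\<close> the negation of \<open>p\<close> is \<open>\<forall>z. \<not> q z\<close>, and \<open>\<forall>z < u. \<not> q z\<close> has an equivalent \<open>r u\<close> one
  level lower. Both \<open>\<forall>u. r u\<close> and \<open>\<forall>u. r u \<longrightarrow> (\<forall>z < u. \<not> q z)\<close> transfer to \<open>K\<close>, so any \<open>d\<close> above \<open>M\<close>
  can be put for \<open>u\<close>.\<close>

lemma neg_sigma_in_K:
  assumes "sigma (n + 2) p" "finite F"
  obtains u d q where "u \<notin> F" "sigma (n + 1) q" "d \<in> su K"
    "\<And>\<rho>. env_in M \<rho> \<Longrightarrow> \<not> sat M \<rho> p \<longleftrightarrow> sat K ((e \<circ> \<rho>)(u := d)) q"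
proof -
  obtain z q where z: "z \<notin> fvars p" "pi (n + 1) q" "eqvM M p (Ex z q)"
    using sigma_contract[of "n + 1" p M "fvars p"] assms ball_closed_M[of "n + 1"] M.pa_minus_axioms by auto
  obtain u where u: "u \<notin> {z} \<union> F \<union> fvars q \<union> fvars p"
    using ex_fresh[of "{z} \<union> F \<union> fvars q \<union> fvars p"] assms by auto
  obtain d where d: "d \<in> su K" "\<forall>m\<in>su M. slt K (e m) d" using above_ex by blast
  have sq: "sigma (n + 1) (ng q)" by (rule pi_ng) (rule z)
  have "SgM M (n + 1) (BAll z (Var u) (ng q))"
    by (intro Sg_BAll ball_closed_M Sg_sigma sq) (use u in auto)
  then obtain r where r: "sigma (n + 1) r" and "eqvM M (BAll z (Var u) (ng q)) r"
    unfolding Sg_def by blast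
  then have rM: "sat M \<rho> r = sat M \<rho> (BAll z (Var u) (ng q))" if "env_in M \<rho>" for \<rho>
    using that unfolding eqvM_iff by blast
  have pM: "sat M \<rho> p \<longleftrightarrow> (\<exists>w\<in>su M. sat M (\<rho>(z := w)) q)" if "env_in M \<rho>" for \<rho>
    using that z(3) by (simp add: eqvM_iff)
  have "Pg {M} {K} (n + 2) (All u r)"
    by (intro Pg_All Pg_Sg[of "n + 1"] Sg_sigma r) auto
  note t1 = transfer_Pg[OF this]
  have "Pg {M} {K} (n + 2) (All u (Impl r (BAll z (Var u) (ng q))))"
    by (intro Pg_All Pg_Impl Pg_BAll Sg_mono[of "n + 1" "n + 2"] Pg_Sg[of "n + 1"] Sg_sigma r sq)
      (use u in auto)
  note t2 = transfer_Pg[OF this]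
  have "Pg {M} {K} (n + 2) q" by (rule Pg_mono[OF _ Pg_pi[OF z(2)]]) simp
  note t3 = transfer_Pg[OF this]
  have main: "\<not> sat M \<rho> p \<longleftrightarrow> sat K ((e \<circ> \<rho>)(u := d)) r" if \<rho>: "env_in M \<rho>" for \<rho>
  proof
    assume np: "\<not> sat M \<rho> p"
    have "sat M (\<rho>(u := b)) r" if b: "b \<in> su M" for b
    proof -
      have "\<not> sat M (\<rho>(u := b, z := w)) q" if "w \<in> su M" for w
      proof -
        have "sat M (\<rho>(u := b, z := w)) q = sat M (\<rho>(z := w)) q"
          by (rule sat_cong) (use u in auto)
        then show ?thesis using np pM[OF \<rho>] that by blast
      qed
      then show ?thesis using rM \<rho> b by simp
    qed
    then have "sat M \<rho> (All u r)" by simp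
    then have "sat K (e \<circ> \<rho>) (All u r)" using t1[OF \<rho>] by blast
    then show "sat K ((e \<circ> \<rho>)(u := d)) r" using d by simp
  next
    assume rK: "sat K ((e \<circ> \<rho>)(u := d)) r"
    show "\<not> sat M \<rho> p"
    proof
      assume "sat M \<rho> p"
      then obtain w where w: "w \<in> su M" "sat M (\<rho>(z := w)) q" using pM \<rho> by blast
      have "sat M \<rho> (All u (Impl r (BAll z (Var u) (ng q))))" using rM \<rho> by simp
      then have "sat K (e \<circ> \<rho>) (All u (Impl r (BAll z (Var u) (ng q))))" using t2[OF \<rho>] by blast
      then have "sat K ((e \<circ> \<rho>)(u := d)) (BAll z (Var u) (ng q))" using d(1) rK by auto
      then have "\<not> sat K ((e \<circ> \<rho>)(u := d, z := e w)) q" using w d u by auto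
      moreover have "sat K ((e \<circ> \<rho>)(u := d, z := e w)) q = sat K (e \<circ> \<rho>(z := w)) q"
        by (rule sat_cong) (use u in auto)
      moreover have "sat K (e \<circ> \<rho>(z := w)) q" using t3 w \<rho> by simp
      ultimately show False by blast
    qed
  qed
  show ?thesis by (rule that[of u r d]) (use u r d main in auto)
qed

lemma ISigma_M:
  assumes MI: "M_ISigma (n + 1) M K e"
  shows "ISigma (n + 2) M"
  unfolding ISigma_def
proof (intro conjI allI impI ballI, rule M.PAminus, rule ccontr)
  fix p x \<rho> a
  assume p: "sigma (n + 2) p" and \<rho>: "env_in M \<rho>" and p0: "sat M (\<rho>(x := sz M)) p"
    and pS: "\<forall>v\<in>su M. sat M (\<rho>(x := v)) p \<longrightarrow> sat M (\<rho>(x := sadd M v (so M))) p"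
    and a: "a \<in> su M" and pa: "\<not> sat M (\<rho>(x := a)) p"
  obtain u d q where u: "u \<notin> {x}" and q: "sigma (n + 1) q" and d: "d \<in> su K"
    and pq: "\<And>\<rho>. env_in M \<rho> \<Longrightarrow> \<not> sat M \<rho> p \<longleftrightarrow> sat K ((e \<circ> \<rho>)(u := d)) q"
    by (rule neg_sigma_in_K[OF p, of "{x}"]) blast+
  obtain c where c: "c \<notin> {x, u} \<union> fvars q" using ex_fresh[of "{x, u} \<union> fvars q"] by auto
  obtain b where b: "b \<notin> {x, u, c} \<union> fvars q" using ex_fresh[of "{x, u, c} \<union> fvars q"] by auto
  obtain t where t: "t \<notin> {x, u, c, b} \<union> fvars q" using ex_fresh[of "{x, u, c, b} \<union> fvars q"] by auto
  \<comment> \<open>The negation of \<open>p\<close> propagates downwards from \<open>a\<close>, so the induction runs over \<open>t = a - c\<close>.\<close>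
  let ?r = "Ex c (Conj (Eq (Add (Var c) (Var t)) (Var b)) (sub (Var(x := Var c)) q))"
  have "SgM K (n + 1) ?r"
    by (intro Sg_Ex Sg_Conj Sg_sub Sg_sigma q Sg_delta0) (auto simp: env_in_def)
  then obtain r where r: "sigma (n + 1) r" and "eqvM K ?r r"
    unfolding Sg_def by blast
  then have rK: "sat K \<rho> r = sat K \<rho> ?r" if "env_in K \<rho>" for \<rho>
    using that unfolding eqvM_iff by blast
  define \<eta> where "\<eta> = (e \<circ> \<rho>)(u := d, b := e a)"
  have \<eta>: "env_in K \<eta>" using \<rho> d a by (simp add: \<eta>_def)
  have sat: "sat K (\<eta>(t := v)) r \<longleftrightarrow>
      (\<exists>c0\<in>su M. sadd K (e c0) v = e a \<and> \<not> sat M (\<rho>(x := c0)) p)" if v: "v \<in> su K" for v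
  proof -
    have "sat K (\<lambda>i. eval K (\<eta>(t := v, c := w)) ((Var(x := Var c)) i)) q =
        sat K ((e \<circ> \<rho>)(u := d, x := w)) q" for w
      by (rule sat_cong) (use u c t b in \<open>auto simp: \<eta>_def\<close>)
    then have 1: "sat K (\<eta>(t := v)) r \<longleftrightarrow>
        (\<exists>w\<in>su K. sadd K w v = e a \<and> sat K ((e \<circ> \<rho>)(u := d, x := w)) q)"
      using c t b rK \<eta> v by (simp add: sat_sub \<eta>_def)
    have 2: "sat K ((e \<circ> \<rho>)(u := d, x := e w)) q \<longleftrightarrow> \<not> sat M (\<rho>(x := w)) p" if "w \<in> su M" for w
    proof -
      have "(e \<circ> \<rho>)(u := d, x := e w) = (e \<circ> \<rho>(x := w))(u := d)" using u by auto
      then show ?thesis using pq \<rho> that by simp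
    qed
    \<comment> \<open>A summand is at most the sum, so w lies in the initial segment given by
      M.\<close>
    have "\<exists>c0\<in>su M. w = e c0" if "w \<in> su K" "sadd K w v = e a" for w
    proof -
      have "slt K w (sadd K (sadd K v w) (so K))" by (rule K.le_add[OF v that(1)])
      also have "sadd K (sadd K v w) (so K) = e (sadd M a (so M))"
        using that v a K.add_commute by (simp add: e_add e_one)
      finally show ?thesis using below_in_M that(1) a by (meson M.add_closed M.one_closed)
    qed
    with 1 2 show ?thesis by (metis e_closed)
  qed
  have "sat K (\<eta>(t := e a)) r"
  proof -
    have "sat K (\<eta>(t := sz K)) r"
      unfolding sat[OF K.zero_closed] using a pa by auto
    \<comment> \<open>M-I Sigma_{n+1} concludes only strictly below its bound, so a + 1 is taken as
      the bound in order to reach t = a. At v = a the premise cannot hold, since it would make p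
      fail at 0.\<close>
    moreover have "sat K (\<eta>(t := sadd K v (so K))) r"
      if v: "v \<in> su K" "slt K v (e (sadd M a (so M)))" "sat K (\<eta>(t := v)) r" for v
    proof -
      obtain t0 where t0: "t0 \<in> su M" "v = e t0" using below_in_M v a by (meson M.add_closed M.one_closed)
      obtain c0 where c0: "c0 \<in> su M" "sadd K (e c0) v = e a" "\<not> sat M (\<rho>(x := c0)) p"
        using v sat by blast
      have "c0 \<noteq> sz M" using c0 p0 by auto
      then obtain c1 where c1: "c1 \<in> su M" "c0 = sadd M c1 (so M)" using M.pred_ex c0 by blast
      have "\<not> sat M (\<rho>(x := c1)) p" using c0 c1 pS by blast
      moreover have "sadd K (e c1) (sadd K v (so K)) = e a"
      proof -
        have "sadd K (e c1) (sadd K v (so K)) = sadd K (e c1) (sadd K (so K) v)"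
          using K.add_commute[OF v(1) K.one_closed] by simp
        also have "\<dots> = sadd K (sadd K (e c1) (so K)) v"
          using c1 v by (simp add: K.add_assoc)
        also have "\<dots> = e a" using c0(2) c1 by (simp add: e_add e_one)
        finally show ?thesis .
      qed
      ultimately show ?thesis using sat[OF K.add_closed[OF v(1) K.one_closed]] c1 by blast
    qed
    moreover have "slt K (e a) (e (sadd M a (so M)))"
      using a M.lt_succ e_lt by simp
    ultimately show ?thesis
      using MI r \<eta> a M.add_closed[OF a M.one_closed] e_closed[OF a] unfolding M_ISigma_def by blast
  qed
  then obtain c0 where c0: "c0 \<in> su M" "sadd K (e c0) (e a) = e a" "\<not> sat M (\<rho>(x := c0)) p"
    using sat a by auto
  then have "sadd K (e c0) (e a) = sadd K (sz K) (e a)" using a by simp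
  then have "e c0 = sz K" using K.add_cancel a c0(1) by (meson K.zero_closed e_closed)
  then have "c0 = sz M" using e_inj c0 e_zero by (metis M.zero_closed)
  then show False using c0 p0 by simp
qed

end

lemma good_ext_ISigma:
  assumes "PAminus M" "good_ext n M K e"
  shows "ISigma (n + 2) M"
proof -
  have "pa_minus K" "pa_minus M" using assms unfolding good_ext_def IDelta0_exp_def
    by (auto simp: ISigma_def pa_minus_def)
  then interpret ext M K e n
    using assms(2) by (auto simp: good_ext_def ext_def ext_axioms_def)
  show ?thesis using ISigma_M assms(2) by (simp add: good_ext_def)
qed

section \<open>The generic filter\<close>

instance trm :: countable by countable_datatype
instance fm :: countable by countable_datatype

fun exs :: "nat list \<Rightarrow> fm \<Rightarrow> fm" where
  "exs [] p = p"
| "exs (x # xs) p = Ex x (exs xs p)"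

lemma sat_exs: "sat S \<rho> (exs xs p) \<longleftrightarrow>
    (\<exists>\<rho>'. (\<forall>i\<in>set xs. \<rho>' i \<in> su S) \<and> (\<forall>i. i \<notin> set xs \<longrightarrow> \<rho>' i = \<rho> i) \<and> sat S \<rho>' p)"
proof (induction xs arbitrary: \<rho>)
  case Nil
  have "\<rho>' = \<rho>" if "\<forall>i. \<rho>' i = \<rho> i" for \<rho>' using that by auto
  then show ?case by auto
next
  case (Cons x xs)
  show ?case
  proof
    assume "sat S \<rho> (exs (x # xs) p)"
    then obtain v \<rho>' where "v \<in> su S" "\<forall>i\<in>set xs. \<rho>' i \<in> su S"
      "\<forall>i. i \<notin> set xs \<longrightarrow> \<rho>' i = (\<rho>(x := v)) i" "sat S \<rho>' p"
      using Cons.IH by auto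
    moreover from this have "\<rho>' x \<in> su S" by (cases "x \<in> set xs") auto
    ultimately show "\<exists>\<rho>'. (\<forall>i\<in>set (x # xs). \<rho>' i \<in> su S) \<and>
        (\<forall>i. i \<notin> set (x # xs) \<longrightarrow> \<rho>' i = \<rho> i) \<and> sat S \<rho>' p"
      by (intro exI[of _ \<rho>']) auto
  next
    assume "\<exists>\<rho>'. (\<forall>i\<in>set (x # xs). \<rho>' i \<in> su S) \<and>
        (\<forall>i. i \<notin> set (x # xs) \<longrightarrow> \<rho>' i = \<rho> i) \<and> sat S \<rho>' p"
    then obtain \<rho>' where \<rho>': "\<forall>i\<in>set (x # xs). \<rho>' i \<in> su S"
        "\<forall>i. i \<notin> set (x # xs) \<longrightarrow> \<rho>' i = \<rho> i" "sat S \<rho>' p" by blast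
    have "sat S (\<rho>(x := \<rho>' x)) (exs xs p)"
      unfolding Cons.IH by (rule exI[of _ \<rho>']) (use \<rho>' in auto)
    then show "sat S \<rho> (exs (x # xs) p)" using \<rho>' by auto
  qed
qed

lemma Sg_exs: "0 < k \<Longrightarrow> Sg A B k p \<Longrightarrow> Sg A B k (exs xs p)"
  by (induction xs) (auto intro: Sg_Ex)

locale forcing = pa_minus M for M :: "'a struc" +
  fixes n :: nat and m :: "nat \<Rightarrow> 'a"
  assumes range_m: "range m = su M"
    and IS: "ISigma (n + 2) M"
begin

text \<open>Even variables are names for the elements of \<open>M\<close>, so formulas need no further parameters;
  odd variables are Henkin constants, and variable \<open>1\<close> is to denote an element above \<open>M\<close>.\<close>

definition E :: "(nat \<Rightarrow> 'a) set" where
  "E = {\<rho>. env_in M \<rho> \<and> (\<forall>i. \<rho> (2 * i) = m i)}"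

definition large :: "((nat \<Rightarrow> 'a) \<Rightarrow> bool) \<Rightarrow> bool" where
  "large P \<longleftrightarrow> (\<forall>b\<in>su M. \<exists>\<rho>\<in>E. slt M b (\<rho> 1) \<and> P \<rho>)"

text \<open>Conditions are handled as predicates on \<open>E\<close>, and only \<open>D\<close>
  remembers that a Sigma_{n+1} formula defines them. This keeps syntax out of the filter
  arguments.\<close>

definition D :: "((nat \<Rightarrow> 'a) \<Rightarrow> bool) \<Rightarrow> bool" where
  "D P \<longleftrightarrow> (\<exists>p. SgM M (n + 1) p \<and> (\<forall>\<rho>\<in>E. P \<rho> = sat M \<rho> p))"

definition cond :: "((nat \<Rightarrow> 'a) \<Rightarrow> bool) \<Rightarrow> bool" where
  "cond P \<longleftrightarrow> D P \<and> large P"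

definition le :: "((nat \<Rightarrow> 'a) \<Rightarrow> bool) \<Rightarrow> ((nat \<Rightarrow> 'a) \<Rightarrow> bool) \<Rightarrow> bool" where
  "le P Q \<longleftrightarrow> (\<forall>\<rho>\<in>E. P \<rho> \<longrightarrow> Q \<rho>)"

lemma m_in [simp]: "m i \<in> su M"
  using range_m by auto

lemma m_ex: "c \<in> su M \<Longrightarrow> \<exists>i. m i = c"
  using range_m by (metis rangeE)

lemma E_env: "\<rho> \<in> E \<Longrightarrow> env_in M \<rho>"
  and E_even: "\<rho> \<in> E \<Longrightarrow> \<rho> (2 * i) = m i"
  by (auto simp: E_def)

lemma E_in: "\<rho> \<in> E \<Longrightarrow> \<rho> i \<in> su M"
  by (rule env_in_D[OF E_env])

lemma E_upd: "\<rho> \<in> E \<Longrightarrow> odd y \<Longrightarrow> v \<in> su M \<Longrightarrow> \<rho>(y := v) \<in> E"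
  by (auto simp: E_def)

lemma E_ex: "v \<in> su M \<Longrightarrow> (\<lambda>i. if even i then m (i div 2) else v) \<in> E"
  by (auto simp: E_def env_in_def)

lemma large_True: "large (\<lambda>_. True)"
  unfolding large_def
proof
  fix b assume b: "b \<in> su M"
  have "(\<lambda>i. if even i then m (i div 2) else sadd M b (so M)) \<in> E"
    using b by (intro E_ex) simp
  then show "\<exists>\<rho>\<in>E. slt M b (\<rho> 1) \<and> True"
    by (rule bexI[rotated]) (use lt_succ b in simp)
qed

lemma large_mono: "large P \<Longrightarrow> le P Q \<Longrightarrow> large Q"
  unfolding large_def le_def by blast

lemma D_sat: "SgM M (n + 1) p \<Longrightarrow> D (\<lambda>\<rho>. sat M \<rho> p)"
  unfolding D_def by blast

lemma D_cong: "D P \<Longrightarrow> (\<And>\<rho>. \<rho> \<in> E \<Longrightarrow> P \<rho> = Q \<rho>) \<Longrightarrow> D Q"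
  unfolding D_def by metis

lemma D_conj: "D P \<Longrightarrow> D Q \<Longrightarrow> D (\<lambda>\<rho>. P \<rho> \<and> Q \<rho>)"
  unfolding D_def
proof (elim exE conjE)
  fix p q assume "SgM M (n + 1) p" "\<forall>\<rho>\<in>E. P \<rho> = sat M \<rho> p" "SgM M (n + 1) q" "\<forall>\<rho>\<in>E. Q \<rho> = sat M \<rho> q"
  then show "\<exists>p. SgM M (n + 1) p \<and> (\<forall>\<rho>\<in>E. (P \<rho> \<and> Q \<rho>) = sat M \<rho> p)"
    by (intro exI[of _ "Conj p q"]) (auto intro: Sg_Conj)
qed

lemma D_rename:
  assumes "SgM M (n + 1) p"
  shows "D (\<lambda>\<rho>. sat M (\<lambda>i. \<rho> (\<sigma> i)) p)"
proof -
  have "SgM M (n + 1) (sub (\<lambda>i. Var (\<sigma> i)) p)"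
    by (rule Sg_sub[OF assms]) (auto simp: env_in_def)
  from D_sat[OF this] show ?thesis by (simp add: sat_sub)
qed

text \<open>Parameters cost nothing: c has a name, so fixing z to c amounts to renaming z to an even
  variable.\<close>

lemma D_inst:
  assumes "SgM M (n + 1) p" "c \<in> su M"
  shows "D (\<lambda>\<rho>. sat M (\<rho>(z := c)) p)"
proof -
  obtain i where i: "m i = c" using m_ex assms by blast
  have "D (\<lambda>\<rho>. sat M (\<lambda>j. \<rho> ((id(z := 2 * i)) j)) p)" by (rule D_rename[OF assms(1)])
  then show ?thesis
  proof (rule D_cong)
    fix \<rho> assume "\<rho> \<in> E"
    then have "(\<lambda>j. \<rho> ((id(z := 2 * i)) j)) = \<rho>(z := c)"
      using i E_even by auto
    then show "sat M (\<lambda>j. \<rho> ((id(z := 2 * i)) j)) p = sat M (\<rho>(z := c)) p" by simp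
  qed
qed

lemma cond_above: "cond P \<Longrightarrow> b \<in> su M \<Longrightarrow> cond (\<lambda>\<rho>. P \<rho> \<and> slt M b (\<rho> 1))"
  unfolding cond_def
proof (elim conjE, intro conjI D_conj)
  assume b: "b \<in> su M" and P: "large P"
  have "D (\<lambda>\<rho>. sat M (\<rho>(2 := b)) (Lt (Var 2) (Var 1)))"
    by (rule D_inst[OF Sg_delta0 b]) simp
  then show "D (\<lambda>\<rho>. slt M b (\<rho> 1))" by simp
  show "large (\<lambda>\<rho>. P \<rho> \<and> slt M b (\<rho> 1))"
    unfolding large_def
  proof
    fix d assume d: "d \<in> su M"
    obtain u where u: "u \<in> su M" "slt M b u" "slt M d u" using ub_ex b d by blast
    then obtain \<rho> where "\<rho> \<in> E" "slt M u (\<rho> 1)" "P \<rho>" using P unfolding large_def by blast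
    then show "\<exists>\<rho>\<in>E. slt M d (\<rho> 1) \<and> P \<rho> \<and> slt M b (\<rho> 1)"
      using u b d lt_trans[OF _ _ E_in] by blast
  qed
qed

text \<open>A bound b on the values of variable 1 compatible with Q is turned into the demand that
  variable 1 exceed b. The negation of Q, which may well be Pi_{n+1}, thus never becomes part of a
  condition.\<close>

lemma cond_not_large:
  assumes "cond P" "\<not> large Q"
  shows "\<exists>P'. cond P' \<and> le P' P \<and> le P' (\<lambda>\<rho>. \<not> Q \<rho>)"
proof -
  obtain b where b: "b \<in> su M" "\<forall>\<rho>\<in>E. slt M b (\<rho> 1) \<longrightarrow> \<not> Q \<rho>"
    using assms(2) unfolding large_def by blast
  with cond_above[OF assms(1) b(1)] show ?thesis unfolding le_def by blast
qed

text \<open>Only the odd variables occurring in \<open>r\<close> have to be quantified, since the even ones are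
  constant on \<open>E\<close>.\<close>

lemma large_formula:
  assumes r: "SgM M (n + 1) r" and z: "z \<noteq> 1"
  shows "\<exists>L. PgM M (n + 2) L \<and> (\<forall>\<rho>\<in>E. \<forall>c\<in>su M.
      sat M (\<rho>(z := c)) L \<longleftrightarrow> large (\<lambda>\<rho>. sat M (\<rho>(z := c)) r))"
proof -
  obtain b where b: "b \<notin> {1, z} \<union> fvars r" using ex_fresh[of "{1, z} \<union> fvars r"] by auto
  \<comment> \<open>Variable 1 is quantified even if r does not mention it, since largeness speaks
    about its value; z is left out because it carries c.\<close>
  obtain xs where xs: "set xs = {i \<in> insert 1 (fvars r). odd i} - {z}"
    using finite_list[of "{i \<in> insert 1 (fvars r). odd i} - {z}"] by auto
  let ?p = "exs xs (Conj (Lt (Var b) (Var 1)) r)"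
  have "PgM M (n + 2) (All b ?p)"
    by (intro Pg_All Pg_Sg[of "n + 1"] Sg_exs Sg_Conj Sg_delta0 r) auto
  moreover have "sat M (\<rho>(z := c)) (All b ?p) \<longleftrightarrow> large (\<lambda>\<rho>. sat M (\<rho>(z := c)) r)"
    if \<rho>: "\<rho> \<in> E" and c: "c \<in> su M" for \<rho> c
  proof -
    have "sat M (\<rho>(z := c, b := d)) ?p \<longleftrightarrow> (\<exists>\<rho>'\<in>E. slt M d (\<rho>' 1) \<and> sat M (\<rho>'(z := c)) r)"
      if d: "d \<in> su M" for d
    proof
      assume "sat M (\<rho>(z := c, b := d)) ?p"
      then obtain \<rho>' where \<rho>': "\<forall>i\<in>set xs. \<rho>' i \<in> su M"
        "\<And>i. i \<notin> set xs \<Longrightarrow> \<rho>' i = (\<rho>(z := c, b := d)) i" "slt M (\<rho>' b) (\<rho>' 1)" "sat M \<rho>' r"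
        unfolding sat_exs by auto
      define \<rho>'' where "\<rho>'' = (\<lambda>i. if i \<in> set xs then \<rho>' i else \<rho> i)"
      have "\<rho>'' \<in> E" using \<rho> \<rho>'(1) xs by (auto simp: \<rho>''_def E_def env_in_def)
      moreover have "\<rho>'' 1 = \<rho>' 1" "\<rho>' b = d"
        using xs z b \<rho>'(2)[of b] by (auto simp: \<rho>''_def)
      moreover have "sat M (\<rho>''(z := c)) r = sat M \<rho>' r"
        by (rule sat_cong) (use xs b \<rho>'(2) in \<open>auto simp: \<rho>''_def\<close>)
      ultimately show "\<exists>\<rho>'\<in>E. slt M d (\<rho>' 1) \<and> sat M (\<rho>'(z := c)) r" using \<rho>' by metis
    next
      assume "\<exists>\<rho>'\<in>E. slt M d (\<rho>' 1) \<and> sat M (\<rho>'(z := c)) r"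
      then obtain \<rho>' where \<rho>': "\<rho>' \<in> E" "slt M d (\<rho>' 1)" "sat M (\<rho>'(z := c)) r" by blast
      have ev: "\<rho> i = \<rho>' i" if "even i" for i
        using E_even[OF \<rho>] E_even[OF \<rho>'(1)] that by (metis evenE)
      define \<rho>'' where "\<rho>'' = (\<lambda>i. if i \<in> set xs then \<rho>' i else (\<rho>(z := c, b := d)) i)"
      have "sat M \<rho>'' r = sat M (\<rho>'(z := c)) r"
        by (rule sat_cong) (use xs b ev in \<open>auto simp: \<rho>''_def\<close>)
      moreover have "\<rho>'' 1 = \<rho>' 1" "\<rho>'' b = d"
        using xs z b by (auto simp: \<rho>''_def)
      ultimately show "sat M (\<rho>(z := c, b := d)) ?p"
        unfolding sat_exs
        by (intro exI[of _ \<rho>'']) (use \<rho>' E_in in \<open>auto simp: \<rho>''_def\<close>)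
    qed
    then show ?thesis by (simp add: large_def)
  qed
  ultimately show ?thesis by blast
qed

section \<open>Extremal indices of large conditions, and density\<close>

lemma E_nonempty: "E \<noteq> {}"
  using E_ex[OF zero_closed] by blast

text \<open>Failure of largeness is the Sigma_{n+2} statement \<open>Neg L\<close>. Without a jump
  it would pass from each c to c + 1 and so reach a.\<close>

lemma large_jump:
  assumes r: "SgM M (n + 1) r" and z: "z \<noteq> 1" and a: "a \<in> su M"
    and 0: "\<not> large (\<lambda>\<rho>. sat M (\<rho>(z := sz M)) r)" and 1: "large (\<lambda>\<rho>. sat M (\<rho>(z := a)) r)"
  shows "\<exists>c\<in>su M. \<not> large (\<lambda>\<rho>. sat M (\<rho>(z := c)) r) \<and>
    large (\<lambda>\<rho>. sat M (\<rho>(z := sadd M c (so M))) r)"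
proof (rule ccontr)
  assume *: "\<not> ?thesis"
  obtain L where L: "PgM M (n + 2) L" and "\<forall>\<rho>\<in>E. \<forall>c\<in>su M.
      sat M (\<rho>(z := c)) L \<longleftrightarrow> large (\<lambda>\<rho>. sat M (\<rho>(z := c)) r)"
    using large_formula[OF r z] by blast
  moreover obtain \<rho> where \<rho>: "\<rho> \<in> E" using E_nonempty by blast
  ultimately have L': "sat M (\<rho>(z := c)) (Neg L) \<longleftrightarrow> \<not> large (\<lambda>\<rho>. sat M (\<rho>(z := c)) r)"
    if "c \<in> su M" for c using that by simp
  have "sat M (\<rho>(z := a)) (Neg L)"
  proof (rule ISigma_induct[OF IS Sg_Neg[OF L] E_env[OF \<rho>] _ _ a])
    show "sat M (\<rho>(z := sz M)) (Neg L)" using 0 L'[OF zero_closed] by blast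
    show "sat M (\<rho>(z := sadd M v (so M))) (Neg L)"
      if "v \<in> su M" "sat M (\<rho>(z := v)) (Neg L)" for v
      using that * L'[OF that(1)] L'[OF add_closed[OF that(1) one_closed]] by blast
  qed
  then show False using L'[OF a] 1 by blast
qed

text \<open>\<open>large_jump\<close> starts from a condition that is not large, so the index is
  reflected by c = m i - t. The endpoint enters the formula through its name, the variable 2 * i,
  which is why z must differ from it.\<close>

lemma large_drop:
  assumes r: "SgM M (n + 1) r" and z: "z \<noteq> 1" "z \<noteq> 2 * i"
    and 0: "large (\<lambda>\<rho>. sat M (\<rho>(z := sz M)) r)" and 1: "\<not> large (\<lambda>\<rho>. sat M (\<rho>(z := m i)) r)"
  shows "\<exists>c\<in>su M. slt M c (m i) \<and> large (\<lambda>\<rho>. sat M (\<rho>(z := c)) r) \<and>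
    \<not> large (\<lambda>\<rho>. sat M (\<rho>(z := sadd M c (so M))) r)"
proof -
  obtain c where c: "c \<notin> {z, 2 * i} \<union> fvars r" using ex_fresh[of "{z, 2 * i} \<union> fvars r"] by auto
  let ?r = "Ex c (Conj (Eq (Add (Var c) (Var z)) (Var (2 * i))) (sub (Var(z := Var c)) r))"
  have Sg: "SgM M (n + 1) ?r"
    by (intro Sg_Ex Sg_Conj Sg_delta0 Sg_sub[OF r]) (auto simp: env_in_def)
  have sat: "sat M (\<rho>(z := t)) ?r \<longleftrightarrow> (\<exists>w\<in>su M. sadd M w t = m i \<and> sat M (\<rho>(z := w)) r)"
    if \<rho>: "\<rho> \<in> E" for \<rho> t
  proof -
    have "sat M (\<lambda>j. eval M (\<rho>(z := t, c := w)) ((Var(z := Var c)) j)) r = sat M (\<rho>(z := w)) r" for w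
      by (rule sat_cong) (use c in auto)
    then show ?thesis using c z E_even[OF \<rho>] by (simp add: sat_sub)
  qed
  have shift: "large (\<lambda>\<rho>. sat M (\<rho>(z := t)) ?r) = large (\<lambda>\<rho>. sat M (\<rho>(z := w)) r)"
    if "t \<in> su M" "w \<in> su M" "sadd M w t = m i" for t w
  proof -
    have "sat M (\<rho>(z := t)) ?r = sat M (\<rho>(z := w)) r" if "\<rho> \<in> E" for \<rho>
      unfolding sat[OF that] using add_cancel \<open>t \<in> su M\<close> \<open>w \<in> su M\<close> \<open>sadd M w t = m i\<close> by metis
    then show ?thesis unfolding large_def by blast
  qed
  have "\<exists>t\<in>su M. \<not> large (\<lambda>\<rho>. sat M (\<rho>(z := t)) ?r) \<and>
    large (\<lambda>\<rho>. sat M (\<rho>(z := sadd M t (so M))) ?r)"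
  proof (rule large_jump[OF Sg z(1) m_in])
    show "\<not> large (\<lambda>\<rho>. sat M (\<rho>(z := sz M)) ?r)" using shift[of "sz M" "m i"] 1 by simp
    show "large (\<lambda>\<rho>. sat M (\<rho>(z := m i)) ?r)" using shift[of "m i" "sz M"] 0 by simp
  qed
  then obtain t where t: "t \<in> su M" "\<not> large (\<lambda>\<rho>. sat M (\<rho>(z := t)) ?r)"
    "large (\<lambda>\<rho>. sat M (\<rho>(z := sadd M t (so M))) ?r)" by blast
  \<comment> \<open>That t + 1 is at most m i is read off from largeness: an assignment satisfying
    the reflected formula provides a w with w + (t + 1) = m i.\<close>
  from t(3) obtain \<rho> where \<rho>: "\<rho> \<in> E" "sat M (\<rho>(z := sadd M t (so M))) ?r"
    unfolding large_def using zero_closed by blast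
  then obtain w where w: "w \<in> su M" "sadd M w (sadd M t (so M)) = m i"
    unfolding sat[OF \<rho>(1)] by blast
  have w': "sadd M (sadd M w (so M)) t = m i"
    using w t(1) add_assoc add_commute[of t "so M"] by simp
  have "slt M w (m i)"
  proof -
    have "slt M w (sadd M w (so M))" using lt_succ w by blast
    moreover have "slt M t (m i) \<or> t = m i \<or> slt M (m i) t" using lt_linear t by simp
    moreover have "slt M (sadd M w (so M)) (sadd M (sadd M t (sadd M w (so M))) (so M))"
      by (rule le_add) (use t w in simp_all)
    then have "slt M (sadd M w (so M)) (sadd M (m i) (so M))"
      using w' add_commute t w by simp
    then have "slt M (sadd M w (so M)) (m i) \<or> sadd M w (so M) = m i"
      using lt_succ_iff w by simp
    ultimately show ?thesis using lt_trans w by (metis add_closed m_in one_closed)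
  qed
  then show ?thesis using w t shift[OF _ _ w(2)] shift[OF _ _ w'] by auto
qed

lemma dense_wit:
  assumes q: "SgM M (n + 1) q" and P: "cond P"
  shows "\<exists>P'. cond P' \<and> le P' P \<and> (le P' (\<lambda>\<rho>. \<not> (\<exists>v\<in>su M. sat M (\<rho>(y := v)) q)) \<or>
    (\<exists>c. le P' (\<lambda>\<rho>. sat M (\<rho>(y := \<rho> c)) q)))"
proof (cases "large (\<lambda>\<rho>. P \<rho> \<and> (\<exists>v\<in>su M. sat M (\<rho>(y := v)) q))")
  case True
  obtain p where p: "\<forall>\<rho>\<in>E. P \<rho> = sat M \<rho> p" using P unfolding cond_def D_def by blast
  obtain k where k: "\<forall>i\<in>fvars p \<union> fvars q \<union> {1, y}. i < k"
    using finite_nat_set_iff_bounded[of "fvars p \<union> fvars q \<union> {1, y}"] by auto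
  \<comment> \<open>The number is odd, so changing its value stays in \<open>E\<close>, and it
    exceeds all variables in play, so the change affects neither P nor q.\<close>
  define c where "c = 2 * k + 1"
  have "c \<notin> fvars p \<union> fvars q \<union> {1, y}"
  proof
    assume "c \<in> fvars p \<union> fvars q \<union> {1, y}"
    then have "c < k" using k by blast
    then show False by (simp add: c_def)
  qed
  then have c: "odd c" "c \<notin> fvars p" "c \<notin> fvars q" "c \<noteq> 1" "c \<noteq> y"
    by (simp_all add: c_def)
  let ?P = "\<lambda>\<rho>. P \<rho> \<and> sat M (\<rho>(y := \<rho> c)) q"
  have Dq: "D (\<lambda>\<rho>. sat M (\<rho>(y := \<rho> c)) q)"
  proof -
    have eq: "(\<lambda>i. \<rho> ((id(y := c)) i)) = \<rho>(y := \<rho> c)" for \<rho> :: "nat \<Rightarrow> 'a" by auto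
    show ?thesis using D_rename[OF q, of "id(y := c)"] by (simp only: eq)
  qed
  have lg: "large ?P"
    unfolding large_def
  proof
    fix b assume "b \<in> su M"
    then obtain \<rho> v where \<rho>: "\<rho> \<in> E" "slt M b (\<rho> 1)" "P \<rho>" "v \<in> su M" "sat M (\<rho>(y := v)) q"
      using True unfolding large_def by blast
    have "\<rho>(c := v) \<in> E" using \<rho> c E_upd by blast
    moreover from this have "P (\<rho>(c := v))" using p \<rho> c by simp
    moreover have "sat M (\<rho>(c := v, y := v)) q" using c \<rho> by simp
    moreover have "slt M b ((\<rho>(c := v)) 1)" "(\<rho>(c := v)) c = v" using \<rho> c by simp_all
    ultimately show "\<exists>\<rho>\<in>E. slt M b (\<rho> 1) \<and> P \<rho> \<and> sat M (\<rho>(y := \<rho> c)) q"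
      by metis
  qed
  have "D P" using P by (simp add: cond_def)
  from D_conj[OF this Dq] lg have "cond ?P" unfolding cond_def by (rule conjI)
  then show ?thesis unfolding le_def by blast
next
  case False
  from cond_not_large[OF P False] obtain P' where P': "cond P'" "le P' P"
    "le P' (\<lambda>\<rho>. \<not> (P \<rho> \<and> (\<exists>v\<in>su M. sat M (\<rho>(y := v)) q)))" by (elim exE conjE)
  have "le P' (\<lambda>\<rho>. \<not> (\<exists>v\<in>su M. sat M (\<rho>(y := v)) q))"
    using P'(2,3) unfolding le_def by blast
  with P'(1,2) show ?thesis by blast
qed

text \<open>The largest \<open>c \<le> m i\<close> for which \<open>P \<and> (\<forall>v < c. q v)\<close> is still large exists by induction in \<open>M\<close>.\<close>

lemma dense_ind:
  assumes q: "SgM M (n + 1) q" and P: "cond P"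
  shows "\<exists>P'. cond P' \<and> le P' P \<and> (\<exists>c\<in>su M. (slt M c (m i) \<or> c = m i) \<and>
    le P' (\<lambda>\<rho>. \<forall>v\<in>su M. slt M v c \<longrightarrow> sat M (\<rho>(x := v)) q) \<and>
    (c = m i \<or> le P' (\<lambda>\<rho>. \<not> sat M (\<rho>(x := c)) q)))"
proof -
  obtain p where p: "SgM M (n + 1) p" "\<forall>\<rho>\<in>E. P \<rho> = sat M \<rho> p"
    using P unfolding cond_def D_def by blast
  obtain z where z: "z \<notin> {1, x, 2 * i} \<union> fvars p \<union> fvars q"
    using ex_fresh[of "{1, x, 2 * i} \<union> fvars p \<union> fvars q"] by auto
  let ?r = "Conj p (BAll x (Var z) q)"
  \<comment> \<open>Collection in M keeps the family Sigma_{n+1} in spite of the bounded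
    quantifier.\<close>
  have "ball_closed M (n + 1)" by (rule ISigma_ball_closed[OF ISigma_mono[OF _ IS]]) simp
  then have r: "SgM M (n + 1) ?r"
    by (intro Sg_Conj Sg_BAll p q) (use z in auto)
  have sat: "sat M (\<rho>(z := c)) ?r \<longleftrightarrow> P \<rho> \<and> (\<forall>v\<in>su M. slt M v c \<longrightarrow> sat M (\<rho>(x := v)) q)"
    if "\<rho> \<in> E" for \<rho> c
    using z p(2) that by simp
  show ?thesis
  proof (cases "large (\<lambda>\<rho>. sat M (\<rho>(z := m i)) ?r)")
    case True
    then have "cond (\<lambda>\<rho>. sat M (\<rho>(z := m i)) ?r)"
      using D_inst[OF r m_in] unfolding cond_def by blast
    moreover have "le (\<lambda>\<rho>. sat M (\<rho>(z := m i)) ?r) P"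
      "le (\<lambda>\<rho>. sat M (\<rho>(z := m i)) ?r) (\<lambda>\<rho>. \<forall>v\<in>su M. slt M v (m i) \<longrightarrow> sat M (\<rho>(x := v)) q)"
      unfolding le_def using sat by blast+
    ultimately show ?thesis using m_in by blast
  next
    case False
    have "large (\<lambda>\<rho>. sat M (\<rho>(z := sz M)) ?r)"
      using P unfolding cond_def
      by (elim conjE large_mono) (auto simp: le_def sat not_lt_zero simp del: sat.simps)
    from large_drop[OF r _ _ this False] z obtain c where c: "c \<in> su M" "slt M c (m i)"
      "large (\<lambda>\<rho>. sat M (\<rho>(z := c)) ?r)" "\<not> large (\<lambda>\<rho>. sat M (\<rho>(z := sadd M c (so M))) ?r)"
      by blast
    have "cond (\<lambda>\<rho>. sat M (\<rho>(z := c)) ?r)"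
      using D_inst[OF r c(1)] c unfolding cond_def by blast
    from cond_not_large[OF this c(4)] obtain P' where P': "cond P'"
      "le P' (\<lambda>\<rho>. sat M (\<rho>(z := c)) ?r)" "le P' (\<lambda>\<rho>. \<not> sat M (\<rho>(z := sadd M c (so M))) ?r)" by blast
    have "le P' P" "le P' (\<lambda>\<rho>. \<forall>v\<in>su M. slt M v c \<longrightarrow> sat M (\<rho>(x := v)) q)"
      using P'(2) sat unfolding le_def by blast+
    \<comment> \<open>Here q holds at all v < c but not at all v < c + 1, so it fails at v =
      c.\<close>
    moreover have "le P' (\<lambda>\<rho>. \<not> sat M (\<rho>(x := c)) q)"
      using P'(2,3) unfolding le_def by (auto simp: sat lt_succ_iff c(1) simp del: sat.simps)
    ultimately show ?thesis using P'(1) c by blast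
  qed
qed

text \<open>If P and \<open>j < m i\<close> are jointly large, there is a c such that
  \<open>j < c + 1\<close> can be added to P but \<open>j < c\<close> cannot. Adding the former and
  refuting the latter leaves only j = c.\<close>

lemma dense_end:
  assumes P: "cond P"
  shows "\<exists>P'. cond P' \<and> le P' P \<and>
    (le P' (\<lambda>\<rho>. \<not> slt M (\<rho> j) (m i)) \<or> (\<exists>c\<in>su M. le P' (\<lambda>\<rho>. \<rho> j = c)))"
proof -
  obtain p where p: "SgM M (n + 1) p" "\<forall>\<rho>\<in>E. P \<rho> = sat M \<rho> p"
    using P unfolding cond_def D_def by blast
  obtain z where z: "z \<notin> {1, j} \<union> fvars p"
    using ex_fresh[of "{1, j} \<union> fvars p"] by auto
  let ?r = "Conj p (Lt (Var j) (Var z))"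
  have r: "SgM M (n + 1) ?r"
    by (intro Sg_Conj Sg_delta0 p) auto
  have sat: "sat M (\<rho>(z := c)) ?r \<longleftrightarrow> P \<rho> \<and> slt M (\<rho> j) c" if "\<rho> \<in> E" for \<rho> c
    using z p(2) that by simp
  show ?thesis
  proof (cases "large (\<lambda>\<rho>. sat M (\<rho>(z := m i)) ?r)")
    case True
    have "\<not> large (\<lambda>\<rho>. sat M (\<rho>(z := sz M)) ?r)"
    proof
      assume "large (\<lambda>\<rho>. sat M (\<rho>(z := sz M)) ?r)"
      then obtain \<rho> where "\<rho> \<in> E" "sat M (\<rho>(z := sz M)) ?r"
        unfolding large_def using zero_closed by blast
      then show False using sat not_lt_zero E_in by blast
    qed
    from large_jump[OF r _ m_in this True] z obtain c where c: "c \<in> su M"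
      "\<not> large (\<lambda>\<rho>. sat M (\<rho>(z := c)) ?r)" "large (\<lambda>\<rho>. sat M (\<rho>(z := sadd M c (so M))) ?r)"
      by blast
    have "cond (\<lambda>\<rho>. sat M (\<rho>(z := sadd M c (so M))) ?r)"
      using D_inst[OF r add_closed[OF c(1) one_closed]] c unfolding cond_def by blast
    from cond_not_large[OF this c(2)] obtain P' where P': "cond P'"
      "le P' (\<lambda>\<rho>. sat M (\<rho>(z := sadd M c (so M))) ?r)" "le P' (\<lambda>\<rho>. \<not> sat M (\<rho>(z := c)) ?r)" by blast
    have "le P' P" using P'(2) sat unfolding le_def by blast
    moreover have "le P' (\<lambda>\<rho>. \<rho> j = c)"
      using P'(2,3) unfolding le_def
      by (auto simp: sat lt_succ_iff c(1) E_in simp del: sat.simps)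
    ultimately show ?thesis using P'(1) c by blast
  next
    case False
    from cond_not_large[OF P False] obtain P' where P': "cond P'" "le P' P"
      "le P' (\<lambda>\<rho>. \<not> sat M (\<rho>(z := m i)) ?r)" by blast
    have "le P' (\<lambda>\<rho>. \<not> slt M (\<rho> j) (m i))"
      using P'(2,3) sat unfolding le_def by blast
    then show ?thesis using P' by blast
  qed
qed

text \<open>The Rasiowa-Sikorski construction. The filter consists of all predicates implied by some
  member of a descending sequence of conditions, not of conditions alone, so that negations of
  conditions can belong to it.\<close>

lemma generic_ex:
  assumes "countable R" "\<And>r P. r \<in> R \<Longrightarrow> cond P \<Longrightarrow> \<exists>P'. cond P' \<and> le P' P \<and> r P'"
  shows "\<exists>F. (\<forall>P. F P \<longrightarrow> large P) \<and> (\<forall>P Q. F P \<longrightarrow> le P Q \<longrightarrow> F Q) \<and>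
    (\<forall>P Q. F P \<longrightarrow> F Q \<longrightarrow> F (\<lambda>\<rho>. P \<rho> \<and> Q \<rho>)) \<and> (\<forall>r\<in>R. \<exists>P. F P \<and> r P) \<and> F (\<lambda>_. True)"
proof (cases "R = {}")
  case True
  show ?thesis
    by (rule exI[of _ "le (\<lambda>_. True)"])
      (use True large_mono[OF large_True] in \<open>auto simp: le_def\<close>)
next
  case False
  have D_True: "D (\<lambda>_. True)"
    using D_sat[OF Sg_delta0, of "Eq Zero Zero"] by simp
  define T where "T = from_nat_into R"
  have T: "T k \<in> R" for k unfolding T_def by (rule from_nat_into[OF False])
  have "\<exists>G. \<forall>k. cond (G k) \<and> (le (G (Suc k)) (G k) \<and> T k (G (Suc k)))"
    by (rule dependent_nat_choice)
      (use assms(2)[OF T] large_True D_True in \<open>auto simp: cond_def\<close>)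
  then obtain G where G: "\<And>k. cond (G k)" "\<And>k. le (G (Suc k)) (G k)" "\<And>k. T k (G (Suc k))" by blast
  have mono: "j \<le> k \<Longrightarrow> le (G k) (G j)" for j k
    by (induction rule: dec_induct) (use G(2) in \<open>auto simp: le_def\<close>)
  define F where "F Q \<longleftrightarrow> (\<exists>k. le (G k) Q)" for Q
  have 1: "large P" if "F P" for P using that G(1) large_mono unfolding F_def cond_def by blast
  have 2: "F Q" if "F P" "le P Q" for P Q using that unfolding F_def le_def by blast
  have 3: "F (\<lambda>\<rho>. P \<rho> \<and> Q \<rho>)" if "F P" "F Q" for P Q
  proof -
    obtain j k where "le (G j) P" "le (G k) Q" using \<open>F P\<close> \<open>F Q\<close> unfolding F_def by blast
    then have "le (G (max j k)) (\<lambda>\<rho>. P \<rho> \<and> Q \<rho>)"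
      using mono[of j "max j k"] mono[of k "max j k"] unfolding le_def by auto
    then show ?thesis unfolding F_def by blast
  qed
  have 4: "\<exists>P. F P \<and> r P" if "r \<in> R" for r
  proof -
    have "\<exists>k. from_nat_into R k = r" by (rule from_nat_into_surj[OF assms(1) that])
    then obtain k where "r = T k" unfolding T_def by blast
    then show ?thesis using G(3)[of k] unfolding F_def le_def by blast
  qed
  have 5: "F (\<lambda>_. True)" by (auto simp: F_def le_def)
  show ?thesis
    by (intro exI[of _ F] conjI allI impI ballI)
      (rule 1, assumption, rule 2, assumption+, rule 3, assumption+, rule 4, assumption, rule 5)
qed

end

text \<open>\<open>F P\<close> is to be read as: P is forced by the generic filter. Decisions can be
  expected only for predicates in \<open>D\<close>. The last three properties are what the three
  density lemmas yield.\<close>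

locale generic = forcing +
  fixes F :: "((nat \<Rightarrow> 'a) \<Rightarrow> bool) \<Rightarrow> bool"
  assumes F_large: "F P \<Longrightarrow> large P"
    and F_mono: "F P \<Longrightarrow> (\<And>\<rho>. \<rho> \<in> E \<Longrightarrow> P \<rho> \<Longrightarrow> Q \<rho>) \<Longrightarrow> F Q"
    and F_conj: "F P \<Longrightarrow> F Q \<Longrightarrow> F (\<lambda>\<rho>. P \<rho> \<and> Q \<rho>)"
    and F_True: "F (\<lambda>_. True)"
    and F_wit: "SgM M (n + 1) q \<Longrightarrow> F (\<lambda>\<rho>. \<not> (\<exists>v\<in>su M. sat M (\<rho>(y := v)) q)) \<or>
      (\<exists>c. F (\<lambda>\<rho>. sat M (\<rho>(y := \<rho> c)) q))"
    and F_ind: "SgM M (n + 1) q \<Longrightarrow> \<exists>c\<in>su M. (slt M c (m i) \<or> c = m i) \<and>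
      F (\<lambda>\<rho>. \<forall>v\<in>su M. slt M v c \<longrightarrow> sat M (\<rho>(x := v)) q) \<and>
      (c = m i \<or> F (\<lambda>\<rho>. \<not> sat M (\<rho>(x := c)) q))"
    and F_end: "F (\<lambda>\<rho>. \<not> slt M (\<rho> j) (m i)) \<or> (\<exists>c\<in>su M. F (\<lambda>\<rho>. \<rho> j = c))"

lemma (in forcing) generic_filter: "\<exists>F. generic M n m F"
proof -
  \<comment> \<open>The guards on q make requirements for formulas outside Sigma_{n+1} trivial, so
    that the requirements are indexed by entire countable types.\<close>
  define r1 where "r1 = (\<lambda>(q, y) P'. SgM M (n + 1) q \<longrightarrow>
    (le P' (\<lambda>\<rho>. \<not> (\<exists>v\<in>su M. sat M (\<rho>(y := v)) q)) \<or> (\<exists>c. le P' (\<lambda>\<rho>. sat M (\<rho>(y := \<rho> c)) q))))"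
  define r2 where "r2 = (\<lambda>(q, x, i) P'. SgM M (n + 1) q \<longrightarrow> (\<exists>c\<in>su M. (slt M c (m i) \<or> c = m i) \<and>
    le P' (\<lambda>\<rho>. \<forall>v\<in>su M. slt M v c \<longrightarrow> sat M (\<rho>(x := v)) q) \<and>
    (c = m i \<or> le P' (\<lambda>\<rho>. \<not> sat M (\<rho>(x := c)) q))))"
  define r3 where "r3 = (\<lambda>(j, i) P'.
    le P' (\<lambda>\<rho>. \<not> slt M (\<rho> j) (m i)) \<or> (\<exists>c\<in>su M. le P' (\<lambda>\<rho>. \<rho> j = c)))"
  let ?R = "range r1 \<union> range r2 \<union> range r3"
  have cnt: "countable ?R" by (intro countable_Un countable_image countableI_type)
  have dense: "\<exists>P'. cond P' \<and> le P' P \<and> r P'" if "r \<in> ?R" "cond P" for r P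
  proof -
    have le: "le P P" by (simp add: le_def)
    have "(\<exists>q y. r = r1 (q, y)) \<or> (\<exists>q x i. r = r2 (q, x, i)) \<or> (\<exists>j i. r = r3 (j, i))"
      using that(1) by (simp add: image_iff disj_assoc)
    then consider q y where "r = r1 (q, y)" | q x i where "r = r2 (q, x, i)" | j i where "r = r3 (j, i)"
      by blast
    then show ?thesis
    proof cases
      case 1
      then show ?thesis
        using dense_wit[OF _ that(2), of q y] that(2) le unfolding r1_def by auto
    next
      case 2
      show ?thesis
      proof (cases "SgM M (n + 1) q")
        case True
        show ?thesis using dense_ind[OF True that(2), of i x] True unfolding 2 r2_def by auto
      next
        case False
        then show ?thesis using that(2) le unfolding 2 r2_def by auto
      qed
    next
      case 3
      then show ?thesis
        using dense_end[OF that(2), of j i] unfolding r3_def by auto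
    qed
  qed
  from generic_ex[OF cnt dense] obtain F where F0: "(\<forall>P. F P \<longrightarrow> large P) \<and> (\<forall>P Q. F P \<longrightarrow> le P Q \<longrightarrow> F Q) \<and>
    (\<forall>P Q. F P \<longrightarrow> F Q \<longrightarrow> F (\<lambda>\<rho>. P \<rho> \<and> Q \<rho>)) \<and> (\<forall>r\<in>?R. \<exists>P. F P \<and> r P) \<and> F (\<lambda>_. True)"
    by (rule exE)
  have F: "\<And>P. F P \<Longrightarrow> large P" "\<And>P Q. F P \<Longrightarrow> le P Q \<Longrightarrow> F Q"
    "\<And>P Q. F P \<Longrightarrow> F Q \<Longrightarrow> F (\<lambda>\<rho>. P \<rho> \<and> Q \<rho>)" "\<And>r. r \<in> ?R \<Longrightarrow> \<exists>P. F P \<and> r P" "F (\<lambda>_. True)"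
    by (rule F0[THEN conjunct1, rule_format], assumption)
      (rule F0[THEN conjunct2, THEN conjunct1, rule_format], assumption+,
       rule F0[THEN conjunct2, THEN conjunct2, THEN conjunct1, rule_format], assumption+,
       rule F0[THEN conjunct2, THEN conjunct2, THEN conjunct2, THEN conjunct1, rule_format], assumption,
       rule F0[THEN conjunct2, THEN conjunct2, THEN conjunct2, THEN conjunct2])
  show ?thesis
  proof (rule exI, rule generic.intro[OF forcing_axioms], rule generic_axioms.intro)
    show "large P" if "F P" for P using F(1) that .
    show "F Q" if "F P" "\<And>\<rho>. \<rho> \<in> E \<Longrightarrow> P \<rho> \<Longrightarrow> Q \<rho>" for P Q
      using F(2)[OF that(1)] that(2) unfolding le_def by blast
    show "F (\<lambda>\<rho>. P \<rho> \<and> Q \<rho>)" if "F P" "F Q" for P Q using F(3) that .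
    show "F (\<lambda>_. True)" by (rule F(5))
    show "F (\<lambda>\<rho>. \<not> (\<exists>v\<in>su M. sat M (\<rho>(y := v)) q)) \<or> (\<exists>c. F (\<lambda>\<rho>. sat M (\<rho>(y := \<rho> c)) q))"
      if "SgM M (n + 1) q" for q y
    proof -
      obtain P where "F P" "r1 (q, y) P" using F(4)[of "r1 (q, y)"] by blast
      then show ?thesis using that F(2) unfolding r1_def split by blast
    qed
    show "\<exists>c\<in>su M. (slt M c (m i) \<or> c = m i) \<and>
        F (\<lambda>\<rho>. \<forall>v\<in>su M. slt M v c \<longrightarrow> sat M (\<rho>(x := v)) q) \<and>
        (c = m i \<or> F (\<lambda>\<rho>. \<not> sat M (\<rho>(x := c)) q))" if "SgM M (n + 1) q" for q x i
    proof -
      obtain P where "F P" "r2 (q, x, i) P" using F(4)[of "r2 (q, x, i)"] by blast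
      then show ?thesis using that F(2) unfolding r2_def split by blast
    qed
    show "F (\<lambda>\<rho>. \<not> slt M (\<rho> j) (m i)) \<or> (\<exists>c\<in>su M. F (\<lambda>\<rho>. \<rho> j = c))" for j i
    proof -
      obtain P where "F P" "r3 (j, i) P" using F(4)[of "r3 (j, i)"] by blast
      then show ?thesis using F(2) unfolding r3_def split by blast
    qed
  qed
qed

section \<open>The Henkin model of a generic filter\<close>

text \<open>The difference of \<open>x < y\<close> is bounded by \<open>y\<close>, so PA^- has bounded matrices throughout and
  truth of bounded formulas in the limit model suffices to obtain it.\<close>

definition pa_matrix :: fm where
  "pa_matrix = (let x = Var 0; y = Var 1; w = Var 2 in
    Conj (Eq (Add x (Add y w)) (Add (Add x y) w))
   (Conj (Eq (Mul x (Mul y w)) (Mul (Mul x y) w))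
   (Conj (Eq (Mul x (Add y w)) (Add (Mul x y) (Mul x w)))
   (Conj (Impl (Conj (Lt x y) (Lt y w)) (Lt x w))
   (Conj (Impl (Lt x y) (Lt (Add x w) (Add y w)))
   (Conj (Impl (Conj (Lt Zero w) (Lt x y)) (Lt (Mul x w) (Mul y w)))
   (Conj (Eq (Add x y) (Add y x))
   (Conj (Eq (Mul x y) (Mul y x))
   (Conj (Disj (Lt x y) (Disj (Eq x y) (Lt y x)))
   (Conj (Impl (Lt x y) (BEx 3 (Add y One) (Eq (Add x (Var 3)) y)))
   (Conj (Eq (Add x Zero) x)
   (Conj (Eq (Mul x Zero) Zero)
   (Conj (Eq (Mul x One) x)
   (Conj (Neg (Lt x x))
   (Conj (Impl (Lt Zero x) (Disj (Eq One x) (Lt One x)))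
   (Conj (Disj (Eq Zero x) (Lt Zero x)) (Lt Zero One)))))))))))))))))"

lemma delta0_pa_matrix: "delta0 pa_matrix"
  by (simp add: pa_matrix_def Let_def)

lemma (in pa_minus) sat_pa_matrix:
  assumes "env_in S \<rho>"
  shows "sat S \<rho> pa_matrix"
proof -
  have in_S: "\<rho> 0 \<in> su S" "\<rho> 1 \<in> su S" "\<rho> 2 \<in> su S" using assms by (auto simp: env_in_def)
  have "\<exists>v\<in>su S. slt S v (sadd S (\<rho> 1) (so S)) \<and> sadd S (\<rho> 0) v = \<rho> 1" if lt: "slt S (\<rho> 0) (\<rho> 1)"
  proof -
    obtain v where v: "v \<in> su S" "sadd S (\<rho> 0) v = \<rho> 1" using lt_diff in_S lt by blast
    then have "slt S v (sadd S (\<rho> 1) (so S))" using le_add in_S by metis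
    with v show ?thesis by blast
  qed
  then have b: "sat S \<rho> (Impl (Lt (Var 0) (Var 1))
      (BEx 3 (Add (Var 1) One) (Eq (Add (Var 0) (Var 3)) (Var 1))))"
    by simp
  let ?x = "\<rho> 0" and ?y = "\<rho> 1" and ?w = "\<rho> 2"
  have 1: "sadd S ?x (sadd S ?y ?w) = sadd S (sadd S ?x ?y) ?w \<and>
       smul S ?x (smul S ?y ?w) = smul S (smul S ?x ?y) ?w \<and>
       smul S ?x (sadd S ?y ?w) = sadd S (smul S ?x ?y) (smul S ?x ?w) \<and>
       (slt S ?x ?y \<and> slt S ?y ?w \<longrightarrow> slt S ?x ?w) \<and>
       (slt S ?x ?y \<longrightarrow> slt S (sadd S ?x ?w) (sadd S ?y ?w)) \<and>
       (slt S (sz S) ?w \<and> slt S ?x ?y \<longrightarrow> slt S (smul S ?x ?w) (smul S ?y ?w))"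
    using PAminus in_S unfolding PAminus_def by blast
  have 2: "sadd S ?x ?y = sadd S ?y ?x \<and> smul S ?x ?y = smul S ?y ?x \<and>
       (slt S ?x ?y \<or> ?x = ?y \<or> slt S ?y ?x)"
    using PAminus in_S unfolding PAminus_def by blast
  have 3: "sadd S ?x (sz S) = ?x \<and> smul S ?x (sz S) = sz S \<and> smul S ?x (so S) = ?x \<and>
       \<not> slt S ?x ?x \<and> (slt S (sz S) ?x \<longrightarrow> (so S = ?x \<or> slt S (so S) ?x)) \<and>
       (sz S = ?x \<or> slt S (sz S) ?x)"
    using PAminus in_S unfolding PAminus_def by blast
  show ?thesis
    unfolding pa_matrix_def Let_def sat.simps(4)
    by (intro conjI b; simp only: sat.simps eval.simps; use 1 2 3 zero_lt_one in blast)
qed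

lemma PAminus_pa_matrix:
  assumes cl: "sz S \<in> su S" "so S \<in> su S"
    "\<And>x y. x \<in> su S \<Longrightarrow> y \<in> su S \<Longrightarrow> sadd S x y \<in> su S"
    "\<And>x y. x \<in> su S \<Longrightarrow> y \<in> su S \<Longrightarrow> smul S x y \<in> su S"
    and sat: "\<And>\<rho>. env_in S \<rho> \<Longrightarrow> sat S \<rho> pa_matrix"
  shows "PAminus S"
proof -
  have ax: "sat S ((\<lambda>_. sz S)(0 := x, 1 := y, 2 := w)) pa_matrix"
    if "x \<in> su S" "y \<in> su S" "w \<in> su S" for x y w
    by (rule sat) (use that cl in \<open>auto simp: env_in_def\<close>)
  note ax = ax[unfolded pa_matrix_def Let_def, simplified]
  have 1: "sadd S x (sadd S y w) = sadd S (sadd S x y) w \<and>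
       smul S x (smul S y w) = smul S (smul S x y) w \<and>
       smul S x (sadd S y w) = sadd S (smul S x y) (smul S x w) \<and>
       (slt S x y \<and> slt S y w \<longrightarrow> slt S x w) \<and>
       (slt S x y \<longrightarrow> slt S (sadd S x w) (sadd S y w)) \<and>
       (slt S (sz S) w \<and> slt S x y \<longrightarrow> slt S (smul S x w) (smul S y w))"
    if "x \<in> su S" "y \<in> su S" "w \<in> su S" for x y w
    using ax[OF that] by blast
  have 2: "sadd S x y = sadd S y x \<and> smul S x y = smul S y x \<and>
       (slt S x y \<or> x = y \<or> slt S y x) \<and>
       (slt S x y \<longrightarrow> (\<exists>w\<in>su S. sadd S x w = y))"
    if "x \<in> su S" "y \<in> su S" for x y
    using ax[OF that cl(1)] by blast
  have 3: "sadd S x (sz S) = x \<and> smul S x (sz S) = sz S \<and> smul S x (so S) = x \<and>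
       \<not> slt S x x \<and> (slt S (sz S) x \<longrightarrow> (so S = x \<or> slt S (so S) x)) \<and>
       (sz S = x \<or> slt S (sz S) x)" "slt S (sz S) (so S)" if "x \<in> su S" for x
    using ax[OF that cl(1) cl(1)] by blast+
  show ?thesis
    unfolding PAminus_def
  proof (rule conjI[OF cl(1) conjI[OF cl(2) conjI[OF _ conjI[OF _ conjI[OF _ conjI]]]]])
    show "\<forall>x\<in>su S. \<forall>y\<in>su S. sadd S x y \<in> su S \<and> smul S x y \<in> su S"
      by (intro ballI conjI cl)
  qed ((intro ballI, rule 1, assumption+), (intro ballI, rule 2, assumption+),
      (intro ballI, rule 3(1), assumption+), rule 3(2)[OF cl(1)])
qed

section \<open>What the filter decides\<close>

context generic
begin

lemma F_all: "(\<And>\<rho>. \<rho> \<in> E \<Longrightarrow> P \<rho>) \<Longrightarrow> F P"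
  using F_mono[OF F_True] by blast

lemma F_mono2: "F P \<Longrightarrow> F Q \<Longrightarrow> (\<And>\<rho>. \<rho> \<in> E \<Longrightarrow> P \<rho> \<Longrightarrow> Q \<rho> \<Longrightarrow> R \<rho>) \<Longrightarrow> F R"
  using F_mono[OF F_conj, of P Q R] by blast

lemma F_mono3: "F P \<Longrightarrow> F Q \<Longrightarrow> F R \<Longrightarrow>
    (\<And>\<rho>. \<rho> \<in> E \<Longrightarrow> P \<rho> \<Longrightarrow> Q \<rho> \<Longrightarrow> R \<rho> \<Longrightarrow> T \<rho>) \<Longrightarrow> F T"
  using F_mono2[OF F_conj[of P Q], of R T] by blast

lemma F_conj_iff: "F (\<lambda>\<rho>. P \<rho> \<and> Q \<rho>) \<longleftrightarrow> F P \<and> F Q"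
proof
  assume "F (\<lambda>\<rho>. P \<rho> \<and> Q \<rho>)"
  from F_mono[OF this, of P] F_mono[OF this, of Q] show "F P \<and> F Q" by simp
qed (simp add: F_conj)

lemma F_const: "F (\<lambda>_. c) \<longleftrightarrow> c"
proof
  assume "F (\<lambda>_. c)"
  from F_large[OF this] show c unfolding large_def using zero_closed by blast
qed (simp add: F_True)

lemma F_not_both: "F P \<Longrightarrow> F (\<lambda>\<rho>. \<not> P \<rho>) \<Longrightarrow> False"
  using F_mono2[of P "\<lambda>\<rho>. \<not> P \<rho>" "\<lambda>_. False"] F_const by blast

text \<open>\<open>F_wit\<close> is applied with a variable y not free in q, which makes both the
  quantifier and the substituted constant vacuous.\<close>

lemma F_decide:
  assumes "D P"
  shows "F P \<or> F (\<lambda>\<rho>. \<not> P \<rho>)"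
proof -
  obtain q where q: "SgM M (n + 1) q" "\<forall>\<rho>\<in>E. P \<rho> = sat M \<rho> q" using assms unfolding D_def by blast
  obtain y where y: "y \<notin> fvars q" using ex_fresh[of "fvars q"] by auto
  have "su M \<noteq> {}" using zero_closed by blast
  then have 1: "F (\<lambda>\<rho>. \<not> sat M \<rho> q) \<or> F (\<lambda>\<rho>. sat M \<rho> q)"
    using F_wit[OF q(1), of y] y by simp
  show ?thesis
  proof (cases "F (\<lambda>\<rho>. sat M \<rho> q)")
    case True
    from F_mono[OF True, of P] q(2) show ?thesis by blast
  next
    case False
    with 1 have "F (\<lambda>\<rho>. \<not> sat M \<rho> q)" by blast
    from F_mono[OF this, of "\<lambda>\<rho>. \<not> P \<rho>"] q(2) show ?thesis by blast
  qed
qed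

lemma F_Not: "D P \<Longrightarrow> F (\<lambda>\<rho>. \<not> P \<rho>) \<longleftrightarrow> \<not> F P"
  using F_decide F_not_both by blast

lemma F_Disj: "D P \<Longrightarrow> F (\<lambda>\<rho>. P \<rho> \<or> Q \<rho>) \<longleftrightarrow> F P \<or> F Q"
proof
  assume P: "D P" and PQ: "F (\<lambda>\<rho>. P \<rho> \<or> Q \<rho>)"
  show "F P \<or> F Q"
  proof (cases "F P")
    case False
    then have "F (\<lambda>\<rho>. \<not> P \<rho>)" using F_Not[OF P] by blast
    from F_mono2[OF PQ this, of Q] show ?thesis by blast
  qed blast
next
  assume "F P \<or> F Q"
  then show "F (\<lambda>\<rho>. P \<rho> \<or> Q \<rho>)"
  proof
    assume "F P" from F_mono[OF this, of "\<lambda>\<rho>. P \<rho> \<or> Q \<rho>"] show ?thesis by blast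
  next
    assume "F Q" from F_mono[OF this, of "\<lambda>\<rho>. P \<rho> \<or> Q \<rho>"] show ?thesis by blast
  qed
qed

section \<open>The term model and its truth lemma\<close>

lemma D_comp: "SgM M (n + 1) p \<Longrightarrow> D (\<lambda>\<rho>. sat M (\<rho> \<circ> \<sigma>) p)"
  using D_rename[of p \<sigma>] by (simp add: comp_def)

text \<open>Variables forced equal are represented by the least among them. The model thus has
  natural numbers as elements and genuine equality, without a quotient.\<close>

definition rp :: "nat \<Rightarrow> nat" where
  "rp i = (LEAST j. F (\<lambda>\<rho>. \<rho> i = \<rho> j))"

lemma F_rp: "F (\<lambda>\<rho>. \<rho> (rp i) = \<rho> i)"
proof -
  have "F (\<lambda>\<rho>. \<rho> i = \<rho> i)" by (rule F_all) simp
  then have "F (\<lambda>\<rho>. \<rho> i = \<rho> (rp i))" unfolding rp_def by (rule LeastI)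
  then show ?thesis by (rule F_mono) simp
qed

lemma rp_eq_iff: "rp i = rp j \<longleftrightarrow> F (\<lambda>\<rho>. \<rho> i = \<rho> j)"
proof
  assume eq: "rp i = rp j"
  show "F (\<lambda>\<rho>. \<rho> i = \<rho> j)" by (rule F_mono2[OF F_rp[of i] F_rp[of j]]) (simp add: eq)
next
  assume eq: "F (\<lambda>\<rho>. \<rho> i = \<rho> j)"
  have "F (\<lambda>\<rho>. \<rho> i = \<rho> k) \<longleftrightarrow> F (\<lambda>\<rho>. \<rho> j = \<rho> k)" for k
    by (rule iffI; erule F_mono2[OF eq]; simp)
  then show "rp i = rp j" unfolding rp_def by simp
qed

lemma rp_rp [simp]: "rp (rp i) = rp i"
  unfolding rp_eq_iff by (rule F_rp)

text \<open>At every assignment in \<open>E\<close> some value of y satisfies y = t, so F cannot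
  refute the existential statement and \<open>F_wit\<close> names the value.\<close>

lemma F_term_ex: "\<exists>k. F (\<lambda>\<rho>. \<rho> k = eval M \<rho> t)"
proof -
  obtain y where y: "y \<notin> tvars t" using ex_fresh[of "tvars t"] by auto
  have "F (\<lambda>\<rho>. \<not> (\<exists>v\<in>su M. sat M (\<rho>(y := v)) (Eq (Var y) t))) \<or>
      (\<exists>c. F (\<lambda>\<rho>. sat M (\<rho>(y := \<rho> c)) (Eq (Var y) t)))"
    by (rule F_wit) (simp add: Sg_delta0)
  moreover have "\<not> F (\<lambda>\<rho>. \<not> (\<exists>v\<in>su M. sat M (\<rho>(y := v)) (Eq (Var y) t)))"
  proof
    assume *: "F (\<lambda>\<rho>. \<not> (\<exists>v\<in>su M. sat M (\<rho>(y := v)) (Eq (Var y) t)))"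
    have "F (\<lambda>_. False)"
      by (rule F_mono[OF *]) (use y eval_closed E_env in auto)
    then show False using F_const by blast
  qed
  ultimately obtain c where "F (\<lambda>\<rho>. sat M (\<rho>(y := \<rho> c)) (Eq (Var y) t))" by blast
  then have "F (\<lambda>\<rho>. \<rho> c = eval M \<rho> t)" by (rule F_mono) (use y in simp)
  then show ?thesis by blast
qed

definition tm :: "trm \<Rightarrow> nat" where
  "tm t = rp (SOME k. F (\<lambda>\<rho>. \<rho> k = eval M \<rho> t))"

lemma F_tm: "F (\<lambda>\<rho>. \<rho> (tm t) = eval M \<rho> t)"
  unfolding tm_def by (rule F_mono2[OF F_rp[of "SOME k. F (\<lambda>\<rho>. \<rho> k = eval M \<rho> t)"] someI_ex[OF F_term_ex[of t]]]) simp

definition K :: "nat struc" where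
  "K = \<lparr>su = range rp, sz = tm Zero, so = tm One,
    sadd = (\<lambda>i j. tm (Add (Var i) (Var j))), smul = (\<lambda>i j. tm (Mul (Var i) (Var j))),
    slt = (\<lambda>i j. F (\<lambda>\<rho>. slt M (\<rho> i) (\<rho> j)))\<rparr>"

lemma rp_in [simp]: "rp i \<in> su K" by (simp add: K_def)

lemma rp_id: "i \<in> su K \<Longrightarrow> rp i = i"
  by (auto simp: K_def)

lemma K_eq_iff: "i \<in> su K \<Longrightarrow> j \<in> su K \<Longrightarrow> i = j \<longleftrightarrow> F (\<lambda>\<rho>. \<rho> i = \<rho> j)"
  using rp_eq_iff[of i j] rp_id by metis

lemma slt_K: "slt K i j \<longleftrightarrow> F (\<lambda>\<rho>. slt M (\<rho> i) (\<rho> j))"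
  by (simp add: K_def)

lemma K_closed [simp]: "sz K \<in> su K" "so K \<in> su K" "sadd K i j \<in> su K" "smul K i j \<in> su K"
  by (simp_all add: K_def tm_def)

lemma F_zero: "F (\<lambda>\<rho>. \<rho> (sz K) = sz M)"
  and F_one: "F (\<lambda>\<rho>. \<rho> (so K) = so M)"
  and F_add: "F (\<lambda>\<rho>. \<rho> (sadd K i j) = sadd M (\<rho> i) (\<rho> j))"
  and F_mul: "F (\<lambda>\<rho>. \<rho> (smul K i j) = smul M (\<rho> i) (\<rho> j))"
  using F_tm[of Zero] F_tm[of One] F_tm[of "Add (Var i) (Var j)"] F_tm[of "Mul (Var i) (Var j)"]
  by (simp_all add: K_def)

lemma eval_K_in: "env_in K \<sigma> \<Longrightarrow> eval K \<sigma> t \<in> su K"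
  by (induction t) (auto simp: env_in_def)

lemma F_eval: "F (\<lambda>\<rho>. \<rho> (eval K \<sigma> t) = eval M (\<rho> \<circ> \<sigma>) t)"
proof (induction t)
  case (Var i)
  show ?case by (rule F_all) simp
next
  case (Add s t)
  show ?case by (rule F_mono3[OF Add.IH F_add[of "eval K \<sigma> s" "eval K \<sigma> t"]]) simp
next
  case (Mul s t)
  show ?case by (rule F_mono3[OF Mul.IH F_mul[of "eval K \<sigma> s" "eval K \<sigma> t"]]) simp
qed (simp_all add: F_zero F_one)

lemma comp_upd: "(\<rho> \<circ> \<sigma>)(x := \<rho> c) = \<rho> \<circ> \<sigma>(x := c)"
  by auto

text \<open>The variable x may also occur as a constant in the range of \<sigma>. Therefore p is
  rewritten along \<sigma>, with a fresh y for x, before \<open>F_wit\<close> is applied.\<close>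

lemma wit_K:
  assumes p: "SgM M (n + 1) p" and ex: "F (\<lambda>\<rho>. \<exists>v\<in>su M. sat M ((\<rho> \<circ> \<sigma>)(x := v)) p)"
  shows "\<exists>c\<in>su K. F (\<lambda>\<rho>. sat M (\<rho> \<circ> \<sigma>(x := c)) p)"
proof -
  let ?s = "Var \<circ> \<sigma>"
  obtain y where y: "y \<notin> svars ?s p" using ex_fresh[of "svars ?s p"] by auto
  let ?q = "sub (?s(x := Var y)) p"
  have q: "sat M (\<rho>(y := v)) ?q = sat M ((\<rho> \<circ> \<sigma>)(x := v)) p" for \<rho> v
    unfolding sat_sub sat_sub_bound[OF y] by (simp add: comp_def)
  have "SgM M (n + 1) ?q"
    by (rule Sg_sub[OF p]) (auto simp: env_in_def)
  from F_wit[OF this, of y]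
  have "F (\<lambda>\<rho>. \<not> (\<exists>v\<in>su M. sat M ((\<rho> \<circ> \<sigma>)(x := v)) p)) \<or>
      (\<exists>c. F (\<lambda>\<rho>. sat M ((\<rho> \<circ> \<sigma>)(x := \<rho> c)) p))"
    unfolding q .
  with ex obtain c where c: "F (\<lambda>\<rho>. sat M ((\<rho> \<circ> \<sigma>)(x := \<rho> c)) p)"
    using F_not_both by blast
  have "F (\<lambda>\<rho>. sat M ((\<rho> \<circ> \<sigma>)(x := \<rho> (rp c))) p)"
    by (rule F_mono2[OF c F_rp[of c]]) simp
  then have "F (\<lambda>\<rho>. sat M (\<rho> \<circ> \<sigma>(x := rp c)) p)" by (simp only: comp_upd)
  then show ?thesis by (rule bexI) simp
qed

text \<open>An assignment into K sends variables to variables, so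
  \<open>\<rho> \<circ> \<sigma>\<close> gives the values in M, under \<rho>, of the elements that
  \<sigma> selects in K.\<close>

definition truth_for :: "fm \<Rightarrow> bool" where
  "truth_for p \<longleftrightarrow> (\<forall>\<sigma>. env_in K \<sigma> \<longrightarrow> sat K \<sigma> p = F (\<lambda>\<rho>. sat M (\<rho> \<circ> \<sigma>) p))"

lemma truth_cong: "truth_for p \<Longrightarrow> (\<And>\<rho>. sat K \<rho> p = sat K \<rho> q) \<Longrightarrow> (\<And>\<rho>. sat M \<rho> p = sat M \<rho> q) \<Longrightarrow> truth_for q"
  by (simp add: truth_for_def)

lemma truth_Eq: "truth_for (Eq s t)"
  unfolding truth_for_def
proof (intro allI impI)
  fix \<sigma> assume "env_in K \<sigma>"
  then have "sat K \<sigma> (Eq s t) \<longleftrightarrow> F (\<lambda>\<rho>. \<rho> (eval K \<sigma> s) = \<rho> (eval K \<sigma> t))"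
    using K_eq_iff eval_K_in by simp
  also have "\<dots> \<longleftrightarrow> F (\<lambda>\<rho>. sat M (\<rho> \<circ> \<sigma>) (Eq s t))"
    by (rule iffI; erule F_mono3[OF F_eval[of \<sigma> s] F_eval[of \<sigma> t]]; simp)
  finally show "sat K \<sigma> (Eq s t) \<longleftrightarrow> F (\<lambda>\<rho>. sat M (\<rho> \<circ> \<sigma>) (Eq s t))" .
qed

lemma truth_Lt: "truth_for (Lt s t)"
  unfolding truth_for_def
proof (intro allI impI)
  fix \<sigma>
  have "sat K \<sigma> (Lt s t) \<longleftrightarrow> F (\<lambda>\<rho>. slt M (\<rho> (eval K \<sigma> s)) (\<rho> (eval K \<sigma> t)))"
    by (simp add: slt_K)
  also have "\<dots> \<longleftrightarrow> F (\<lambda>\<rho>. sat M (\<rho> \<circ> \<sigma>) (Lt s t))"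
    by (rule iffI; erule F_mono3[OF F_eval[of \<sigma> s] F_eval[of \<sigma> t]]; simp)
  finally show "sat K \<sigma> (Lt s t) \<longleftrightarrow> F (\<lambda>\<rho>. sat M (\<rho> \<circ> \<sigma>) (Lt s t))" .
qed

lemma truth_Neg: "SgM M (n + 1) p \<Longrightarrow> truth_for p \<Longrightarrow> truth_for (Neg p)"
  by (simp add: truth_for_def F_Not[OF D_comp])

lemma truth_Conj: "truth_for p \<Longrightarrow> truth_for q \<Longrightarrow> truth_for (Conj p q)"
  by (simp add: truth_for_def F_conj_iff)

lemma truth_Disj: "SgM M (n + 1) p \<Longrightarrow> truth_for p \<Longrightarrow> truth_for q \<Longrightarrow> truth_for (Disj p q)"
  by (simp add: truth_for_def F_Disj[OF D_comp])

lemma truth_Ex: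
  assumes "SgM M (n + 1) p" "truth_for p"
  shows "truth_for (Ex x p)"
  unfolding truth_for_def
proof (intro allI impI)
  fix \<sigma> assume \<sigma>: "env_in K \<sigma>"
  then have "sat K \<sigma> (Ex x p) \<longleftrightarrow> (\<exists>c\<in>su K. F (\<lambda>\<rho>. sat M (\<rho> \<circ> \<sigma>(x := c)) p))"
    using assms(2) by (simp add: truth_for_def)
  also have "\<dots> \<longleftrightarrow> F (\<lambda>\<rho>. sat M (\<rho> \<circ> \<sigma>) (Ex x p))"
  proof
    assume "\<exists>c\<in>su K. F (\<lambda>\<rho>. sat M (\<rho> \<circ> \<sigma>(x := c)) p)"
    then obtain c where "F (\<lambda>\<rho>. sat M (\<rho> \<circ> \<sigma>(x := c)) p)" by blast
    then show "F (\<lambda>\<rho>. sat M (\<rho> \<circ> \<sigma>) (Ex x p))"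
    proof (rule F_mono)
      fix \<rho> assume \<rho>: "\<rho> \<in> E" "sat M (\<rho> \<circ> \<sigma>(x := c)) p"
      then have "sat M ((\<rho> \<circ> \<sigma>)(x := \<rho> c)) p" by (simp only: comp_upd)
      then show "sat M (\<rho> \<circ> \<sigma>) (Ex x p)" using E_in[OF \<rho>(1)] by auto
    qed
  next
    assume "F (\<lambda>\<rho>. sat M (\<rho> \<circ> \<sigma>) (Ex x p))"
    then show "\<exists>c\<in>su K. F (\<lambda>\<rho>. sat M (\<rho> \<circ> \<sigma>(x := c)) p)"
      unfolding sat.simps by (rule wit_K[OF assms(1)])
  qed
  finally show "sat K \<sigma> (Ex x p) \<longleftrightarrow> F (\<lambda>\<rho>. sat M (\<rho> \<circ> \<sigma>) (Ex x p))" .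
qed

lemma truth_All:
  assumes "SgM M (n + 1) p" "SgM M (n + 1) (Neg p)" "truth_for p"
  shows "truth_for (All x p)"
proof -
  have "truth_for (Neg (Ex x (Neg p)))"
    by (intro truth_Neg truth_Ex Sg_Ex assms) simp
  then show ?thesis by (rule truth_cong) simp_all
qed

lemma truth_delta0: "delta0 p \<Longrightarrow> truth_for p"
proof (induction p)
  case (Eq s t)
  show ?case by (rule truth_Eq)
next
  case (Lt s t)
  show ?case by (rule truth_Lt)
next
  case (Neg p)
  then show ?case by (auto intro: truth_Neg Sg_delta0)
next
  case (Conj p q)
  then show ?case by (auto intro: truth_Conj)
next
  case (Disj p q)
  then show ?case by (auto intro: truth_Disj Sg_delta0)
next
  case (Impl p q)
  then have "truth_for (Disj (Neg p) q)" by (auto intro!: truth_Disj truth_Neg Sg_delta0)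
  then show ?case by (rule truth_cong) auto
next
  case (BEx x t p)
  then have "truth_for (Ex x (Conj (Lt (Var x) t) p))"
    by (auto intro!: truth_Ex truth_Conj truth_Lt Sg_delta0)
  then show ?case by (rule truth_cong) (use BEx.prems in auto)
next
  case (BAll x t p)
  then have "truth_for (Neg (Ex x (Conj (Lt (Var x) t) (Neg p))))"
    by (intro truth_Neg truth_Ex Sg_Ex truth_Conj truth_Lt Sg_delta0) auto
  then show ?case by (rule truth_cong) (use BAll.prems in auto)
qed auto

text \<open>For k at most n, a Pi_k matrix and its negation are both Sigma_{n+1} and hence decided
  by F, which is what \<open>truth_All\<close> asks for. On the Sigma side existential quantifiers
  need witnesses only, so one more level is reached.\<close>

lemma truth_sigma_pi: "(sigma k p \<longrightarrow> k \<le> n + 1 \<longrightarrow> truth_for p) \<and> (pi k p \<longrightarrow> k \<le> n \<longrightarrow> truth_for p)"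
proof (rule sigma_pi.induct[of "\<lambda>k p. k \<le> n + 1 \<longrightarrow> truth_for p" "\<lambda>k p. k \<le> n \<longrightarrow> truth_for p"], goal_cases)
  case (4 k p x)
  show ?case
  proof
    assume k: "Suc k \<le> n + 1"
    show "truth_for (Ex x p)" by (rule truth_Ex[OF Sg_mono[OF k Sg_sigma]]) (use 4 k in auto)
  qed
next
  case (6 k p x)
  show ?case
  proof
    assume k: "Suc k \<le> n"
    show "truth_for (All x p)"
    proof (rule truth_All)
      show "SgM M (n + 1) p" by (rule Sg_Pg[OF _ Pg_pi[OF 6(1)]]) (use k in simp)
      show "SgM M (n + 1) (Neg p)" by (rule Sg_Neg, rule Pg_mono[OF _ Pg_pi[OF 6(1)]]) (use k in simp)
      show "truth_for p" using 6 k by blast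
    qed
  qed
qed (auto simp: truth_delta0)

lemma truth: "sigma (n + 1) p \<Longrightarrow> env_in K \<sigma> \<Longrightarrow> sat K \<sigma> p \<longleftrightarrow> F (\<lambda>\<rho>. sat M (\<rho> \<circ> \<sigma>) p)"
  using truth_sigma_pi[of "n + 1" p] by (simp add: truth_for_def)

lemma truth0: "delta0 p \<Longrightarrow> env_in K \<sigma> \<Longrightarrow> sat K \<sigma> p \<longleftrightarrow> F (\<lambda>\<rho>. sat M (\<rho> \<circ> \<sigma>) p)"
  using truth_delta0 by (simp add: truth_for_def)

text \<open>Universal quantifiers above Sigma_{n+1} cause no trouble in this direction: a universal
  statement true in M under \<rho> holds in particular at the value \<rho> c of each element c of K,
  and no decision is called for.\<close>

lemma pi_up:
  assumes "pi (n + 2) p" "env_in K \<sigma>" "F (\<lambda>\<rho>. sat M (\<rho> \<circ> \<sigma>) p)"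
  shows "sat K \<sigma> p"
proof -
  have "pi (Suc (n + 1)) p" using assms(1) by simp
  then show ?thesis using assms(2,3)
  proof (induction arbitrary: \<sigma> rule: pi_Suc_induct)
    case (base q)
    then show ?case using truth by blast
  next
    case (all x q)
    have "sat K (\<sigma>(x := c)) q" if c: "c \<in> su K" for c
    proof (rule all.IH)
      show "env_in K (\<sigma>(x := c))" using all.prems c by simp
      from all.prems(2) show "F (\<lambda>\<rho>. sat M (\<rho> \<circ> \<sigma>(x := c)) q)"
      proof (rule F_mono)
        fix \<rho> assume \<rho>: "\<rho> \<in> E" "sat M (\<rho> \<circ> \<sigma>) (All x q)"
        then have "sat M ((\<rho> \<circ> \<sigma>)(x := \<rho> c)) q" using E_in by simp
        then show "sat M (\<rho> \<circ> \<sigma>(x := c)) q" by (simp only: comp_upd)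
      qed
    qed
    then show ?case by simp
  qed
qed

section \<open>Embedding of M and Sigma_{n+2} elementarity\<close>

definition nm :: "'a \<Rightarrow> nat" where
  "nm x = rp (2 * (SOME i. m i = x))"

lemma nm_in [simp]: "nm x \<in> su K"
  by (simp add: nm_def)

lemma F_nm: "x \<in> su M \<Longrightarrow> F (\<lambda>\<rho>. \<rho> (nm x) = x)"
proof -
  assume "x \<in> su M"
  then have x: "m (SOME i. m i = x) = x" using someI_ex[OF m_ex] by blast
  show ?thesis unfolding nm_def
    by (rule F_mono[OF F_rp[of "2 * (SOME i. m i = x)"]]) (simp add: E_even x)
qed

lemma env_nm [simp]: "env_in K (nm \<circ> \<rho>)"
  by (simp add: env_in_def)

lemma F_finite: "finite A \<Longrightarrow> (\<And>i. i \<in> A \<Longrightarrow> F (P i)) \<Longrightarrow> F (\<lambda>\<rho>. \<forall>i\<in>A. P i \<rho>)"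
  by (induction rule: finite_induct) (simp_all add: F_True F_conj)

lemma F_sat_nm:
  assumes "env_in M \<eta>"
  shows "F (\<lambda>\<rho>. sat M (\<rho> \<circ> (nm \<circ> \<eta>)) p) \<longleftrightarrow> sat M \<eta> p"
proof -
  \<comment> \<open>Closure under finite intersections is all that a filter offers, so the names are
    matched with their values on the finitely many free variables of p only.\<close>
  have *: "F (\<lambda>\<rho>. \<forall>i\<in>fvars p. \<rho> (nm (\<eta> i)) = \<eta> i)"
    using assms by (intro F_finite F_nm) (auto simp: env_in_def)
  have "F (\<lambda>\<rho>. sat M (\<rho> \<circ> (nm \<circ> \<eta>)) p = sat M \<eta> p)"
    by (rule F_mono[OF *]) (rule sat_cong, simp)
  note eq = this
  have "F (\<lambda>\<rho>. sat M (\<rho> \<circ> (nm \<circ> \<eta>)) p) \<longleftrightarrow> F (\<lambda>_. sat M \<eta> p)"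
    by (rule iffI; erule F_mono2[OF eq]; blast)
  then show ?thesis by (simp add: F_const)
qed

lemma pi_nm: "pi (n + 2) p \<Longrightarrow> env_in M \<eta> \<Longrightarrow> sat M \<eta> p \<Longrightarrow> sat K (nm \<circ> \<eta>) p"
  by (rule pi_up) (simp_all add: F_sat_nm)

lemma sigma_nm:
  assumes "sigma (n + 2) p" "env_in M \<eta>" "sat M \<eta> p"
  shows "sat K (nm \<circ> \<eta>) p"
proof -
  have "sigma (Suc (n + 1)) p" using assms(1) by simp
  then show ?thesis using assms(2,3)
  proof (induction arbitrary: \<eta> rule: sigma_Suc_induct)
    case (base q)
    have "pi (n + 2) q" by (rule pi_mono[OF _ base(1)]) simp
    then show ?case using pi_nm base by blast
  next
    case (ex x q)
    then obtain v where v: "v \<in> su M" "sat M (\<eta>(x := v)) q" by auto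
    have "sat K (nm \<circ> \<eta>(x := v)) q"
      by (rule ex.IH) (use ex.prems v in \<open>simp_all del: fun_upd_apply\<close>)
    moreover have "nm \<circ> \<eta>(x := v) = (nm \<circ> \<eta>)(x := nm v)" by auto
    ultimately show ?case by (metis nm_in sat.simps(7))
  qed
qed

text \<open>Both Sigma_{n+2} and Pi_{n+2} truths pass upward. Reflection to M is the upward passage
  of the negation \<open>ng p\<close>.\<close>

lemma sigma_elem_K: "sigma_elem (n + 2) M K nm"
  unfolding sigma_elem_def
proof (intro allI impI iffI)
  fix p \<eta> assume p: "sigma (n + 2) p" and \<eta>: "env_in M \<eta>"
  show "sat K (nm \<circ> \<eta>) p" if "sat M \<eta> p" using sigma_nm p \<eta> that by blast
  show "sat M \<eta> p" if "sat K (nm \<circ> \<eta>) p"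
    using pi_nm[OF sigma_ng[OF p] \<eta>] that by auto
qed

section \<open>The term model satisfies I Delta_0 + exp\<close>

lemma PAminus_K: "PAminus K"
proof (rule PAminus_pa_matrix)
  fix \<sigma> assume \<sigma>: "env_in K \<sigma>"
  have "F (\<lambda>\<rho>. sat M (\<rho> \<circ> \<sigma>) pa_matrix)"
    by (rule F_all, rule sat_pa_matrix) (simp add: env_in_def E_in)
  then show "sat K \<sigma> pa_matrix" using truth0[OF delta0_pa_matrix \<sigma>] by blast
qed simp_all

sublocale K: pa_minus K
  by unfold_locales (rule PAminus_K)

text \<open>At an assignment where p holds at 0 and fails at a, induction in M gives a v with p(v)
  and not p(v + 1). This property of v is Delta_0, so \<open>wit_K\<close> turns it into an element
  of K at which the induction step fails.\<close>

lemma ISigma0_K: "ISigma 0 K"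
  unfolding ISigma_def
proof (intro conjI PAminus_K allI impI ballI)
  fix p x \<sigma> a
  assume p: "sigma 0 p" and \<sigma>: "env_in K \<sigma>" and p0: "sat K (\<sigma>(x := sz K)) p"
    and pS: "\<forall>v\<in>su K. sat K (\<sigma>(x := v)) p \<longrightarrow> sat K (\<sigma>(x := sadd K v (so K))) p"
    and a: "a \<in> su K"
  have tr: "sat K (\<sigma>(x := v)) p \<longleftrightarrow> F (\<lambda>\<rho>. sat M ((\<rho> \<circ> \<sigma>)(x := \<rho> v)) p)" if "v \<in> su K" for v
    unfolding comp_upd by (rule truth0) (use p \<sigma> that in auto)
  let ?q = "Conj p (Neg (sub (Var(x := Add (Var x) One)) p))"
  have q: "SgM M (n + 1) ?q"
    by (rule Sg_delta0) (use p delta0_sub in auto)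
  have sq: "sat M (\<rho>(x := v)) ?q \<longleftrightarrow> sat M (\<rho>(x := v)) p \<and> \<not> sat M (\<rho>(x := sadd M v (so M))) p" for \<rho> v
  proof -
    have "(\<lambda>i. eval M (\<rho>(x := v)) ((Var(x := Add (Var x) One)) i)) = \<rho>(x := sadd M v (so M))" by auto
    then show ?thesis by (simp add: sat_sub)
  qed
  show "sat K (\<sigma>(x := a)) p"
  proof (rule ccontr)
    assume "\<not> ?thesis"
    moreover have "D (\<lambda>\<rho>. sat M (\<rho> \<circ> \<sigma>(x := a)) p)"
      by (rule D_comp[OF Sg_delta0]) (use p in simp)
    ultimately have na: "F (\<lambda>\<rho>. \<not> sat M ((\<rho> \<circ> \<sigma>)(x := \<rho> a)) p)"
      using tr[OF a] F_Not unfolding comp_upd by blast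
    have 0: "F (\<lambda>\<rho>. sat M ((\<rho> \<circ> \<sigma>)(x := \<rho> (sz K))) p)" using tr p0 by simp
    have "F (\<lambda>\<rho>. \<exists>v\<in>su M. sat M ((\<rho> \<circ> \<sigma>)(x := v)) ?q)"
    proof (rule F_mono3[OF na 0 F_zero])
      fix \<rho> assume \<rho>: "\<rho> \<in> E" "\<not> sat M ((\<rho> \<circ> \<sigma>)(x := \<rho> a)) p"
        "sat M ((\<rho> \<circ> \<sigma>)(x := \<rho> (sz K))) p" "\<rho> (sz K) = sz M"
      have env: "env_in M (\<rho> \<circ> \<sigma>)" using E_in[OF \<rho>(1)] by (simp add: env_in_def)
      have I0: "ISigma 0 M" by (rule ISigma_mono[OF _ IS]) simp
      have pS0: "SgM M 0 p" using p by (rule Sg_sigma)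
      show "\<exists>v\<in>su M. sat M ((\<rho> \<circ> \<sigma>)(x := v)) ?q"
      proof (rule ccontr)
        assume no: "\<not> ?thesis"
        have "sat M ((\<rho> \<circ> \<sigma>)(x := \<rho> a)) p"
          by (rule ISigma_induct[OF I0 pS0 env]) (use \<rho> no sq E_in in auto)
        then show False using \<rho> by blast
      qed
    qed
    from wit_K[OF q this] obtain c where c: "c \<in> su K"
      "F (\<lambda>\<rho>. sat M ((\<rho> \<circ> \<sigma>)(x := \<rho> c)) ?q)" unfolding comp_upd by blast
    then have c': "F (\<lambda>\<rho>. sat M ((\<rho> \<circ> \<sigma>)(x := \<rho> c)) p)"
      "F (\<lambda>\<rho>. \<not> sat M ((\<rho> \<circ> \<sigma>)(x := sadd M (\<rho> c) (so M))) p)"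
      unfolding sq F_conj_iff by blast+
    have "sat K (\<sigma>(x := sadd K c (so K))) p" using tr c'(1) c(1) pS by blast
    then have *: "F (\<lambda>\<rho>. sat M ((\<rho> \<circ> \<sigma>)(x := \<rho> (sadd K c (so K)))) p)" using tr by simp
    have "F (\<lambda>\<rho>. sat M ((\<rho> \<circ> \<sigma>)(x := sadd M (\<rho> c) (so M))) p)"
      by (rule F_mono3[OF * F_add[of c "so K"] F_one]) simp
    then show False using c'(2) F_not_both by blast
  qed
qed

text \<open>The same Delta_0 formula serves as the graph in K. Recursion and uniqueness hold at each
  assignment in \<open>E\<close> and are therefore forced; totality is converted by
  \<open>wit_K\<close> into a value in K.\<close>

lemma exp_K:
  assumes "exp_ax M"
  shows "exp_ax K"
proof -
  define R where "R = (\<lambda>p x y. sat M ((\<lambda>_. sz M)(0 := x, 1 := y)) p)"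
  define RK where "RK = (\<lambda>p x y. sat K ((\<lambda>_. sz K)(0 := x, 1 := y)) p)"
  obtain p where p: "delta0 p" "fvars p \<subseteq> {0, 1}" and R0: "R p (sz M) (so M)"
    and RS: "\<And>x y. x \<in> su M \<Longrightarrow> y \<in> su M \<Longrightarrow> R p x y \<Longrightarrow> R p (sadd M x (so M)) (sadd M y y)"
    and Rex: "\<And>x. x \<in> su M \<Longrightarrow> \<exists>!y. y \<in> su M \<and> R p x y"
    using assms unfolding exp_ax_def Let_def R_def by auto
  have comp: "sat M ((\<rho> \<circ> (\<lambda>_. sz K)(0 := x))(1 := v)) p \<longleftrightarrow> R p (\<rho> x) v" for \<rho> x v
    unfolding R_def by (rule sat_cong) (use p in auto)
  have RK: "RK p x y \<longleftrightarrow> F (\<lambda>\<rho>. R p (\<rho> x) (\<rho> y))" if "x \<in> su K" "y \<in> su K" for x y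
    unfolding RK_def comp[symmetric] comp_upd
    by (rule truth0[OF p(1)]) (use that in \<open>auto simp: env_in_def\<close>)
  have "RK p (sz K) (so K)"
    by (subst RK, simp, simp, rule F_mono2[OF F_zero F_one]) (simp add: R0)
  moreover have "RK p (sadd K x (so K)) (sadd K y y)"
    if x: "x \<in> su K" and y: "y \<in> su K" and xy: "RK p x y" for x y
  proof -
    have 1: "F (\<lambda>\<rho>. \<rho> (sadd K x (so K)) = sadd M (\<rho> x) (so M))"
      by (rule F_mono2[OF F_add[of x "so K"] F_one]) simp
    have "F (\<lambda>\<rho>. R p (\<rho> (sadd K x (so K))) (\<rho> (sadd K y y)))"
      by (rule F_mono3[OF xy[unfolded RK[OF x y]] 1 F_add[of y y]]) (simp add: RS E_in)
    then show ?thesis by (simp add: RK)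
  qed
  moreover have "\<exists>!y. y \<in> su K \<and> RK p x y" if x: "x \<in> su K" for x
  proof -
    have "F (\<lambda>\<rho>. \<exists>v\<in>su M. sat M ((\<rho> \<circ> (\<lambda>_. sz K)(0 := x))(1 := v)) p)"
      unfolding comp by (rule F_all) (use Rex E_in in blast)
    from wit_K[OF Sg_delta0[OF p(1)] this] obtain y where y: "y \<in> su K" "RK p x y"
      using RK x unfolding comp[symmetric] comp_upd by blast
    moreover have "y' = y" if y': "y' \<in> su K" "RK p x y'" for y'
    proof -
      have "F (\<lambda>\<rho>. \<rho> y' = \<rho> y)"
      proof (rule F_mono2)
        show "F (\<lambda>\<rho>. R p (\<rho> x) (\<rho> y))" "F (\<lambda>\<rho>. R p (\<rho> x) (\<rho> y'))" using x y y' RK by blast+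
        fix \<rho> assume \<rho>: "\<rho> \<in> E" "R p (\<rho> x) (\<rho> y)" "R p (\<rho> x) (\<rho> y')"
        then show "\<rho> y' = \<rho> y" using Rex[OF E_in[OF \<rho>(1)]] E_in[OF \<rho>(1)] by blast
      qed
      then show ?thesis using K_eq_iff y y' by blast
    qed
    ultimately show ?thesis by blast
  qed
  ultimately show ?thesis
    unfolding exp_ax_def Let_def using p unfolding RK_def by blast
qed

section \<open>End extension and induction up to elements of M\<close>

lemma F_nm_lt: "x \<in> su M \<Longrightarrow> y \<in> su M \<Longrightarrow> slt K (nm x) (nm y) \<longleftrightarrow> slt M x y"
proof -
  assume x: "x \<in> su M" and y: "y \<in> su M"
  have "slt K (nm x) (nm y) \<longleftrightarrow> F (\<lambda>_. slt M x y)"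
    unfolding slt_K by (rule iffI; erule F_mono3[OF F_nm[OF x] F_nm[OF y]]; simp)
  then show ?thesis by (simp add: F_const)
qed

lemma nm_hom:
  assumes "x \<in> su M" "y \<in> su M"
  shows "nm (sadd M x y) = sadd K (nm x) (nm y)" "nm (smul M x y) = smul K (nm x) (nm y)"
proof -
  note xy = F_conj[OF F_nm[OF assms(1)] F_nm[OF assms(2)]]
  have "F (\<lambda>\<rho>. \<rho> (nm (sadd M x y)) = \<rho> (sadd K (nm x) (nm y)))"
    by (rule F_mono3[OF xy F_nm[OF add_closed[OF assms]] F_add[of "nm x" "nm y"]]) simp
  then show "nm (sadd M x y) = sadd K (nm x) (nm y)" by (subst K_eq_iff) simp_all
  have "F (\<lambda>\<rho>. \<rho> (nm (smul M x y)) = \<rho> (smul K (nm x) (nm y)))"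
    by (rule F_mono3[OF xy F_nm[OF mul_closed[OF assms]] F_mul[of "nm x" "nm y"]]) simp
  then show "nm (smul M x y) = smul K (nm x) (nm y)" by (subst K_eq_iff) simp_all
qed

lemma nm_zero: "nm (sz M) = sz K"
  by (subst K_eq_iff, simp, simp, rule F_mono2[OF F_nm[OF zero_closed] F_zero]) simp

lemma nm_one: "nm (so M) = so K"
  by (subst K_eq_iff, simp, simp, rule F_mono2[OF F_nm[OF one_closed] F_one]) simp

lemma nm_inj: "inj_on nm (su M)"
proof (rule inj_onI)
  fix x y assume x: "x \<in> su M" and y: "y \<in> su M" and eq: "nm x = nm y"
  have "F (\<lambda>_. x = y)" by (rule F_mono2[OF F_nm[OF x] F_nm[OF y]]) (metis eq)
  then show "x = y" by (simp add: F_const)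
qed

lemma nm_end:
  assumes k: "k \<in> su K" and x: "x \<in> su M" and lt: "slt K k (nm x)"
  shows "k \<in> nm ` su M"
proof -
  obtain i where i: "m i = x" using m_ex x by blast
  have l: "F (\<lambda>\<rho>. slt M (\<rho> k) (m i))"
    by (rule F_mono2[OF lt[unfolded slt_K] F_nm[OF x]]) (simp add: i)
  then obtain c where c: "c \<in> su M" "F (\<lambda>\<rho>. \<rho> k = c)"
    using F_end[of k i] F_not_both by blast
  have "F (\<lambda>\<rho>. \<rho> k = \<rho> (nm c))" by (rule F_mono2[OF c(2) F_nm[OF c(1)]]) simp
  then have "k = nm c" using K_eq_iff k by simp
  then show ?thesis using c by blast
qed

lemma proper_end_ext_K: "proper_end_ext M K nm"
proof -
  have "\<forall>k\<in>su K - nm ` su M. \<forall>x\<in>su M. slt K (nm x) k"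
  proof (intro ballI)
    fix k x assume k: "k \<in> su K - nm ` su M" and x: "x \<in> su M"
    then have "\<not> slt K k (nm x)" "k \<noteq> nm x" using nm_end by blast+
    then show "slt K (nm x) k" using K.lt_linear[of k "nm x"] k by auto
  qed
  moreover have "rp 1 \<notin> nm ` su M"
  proof
    assume "rp 1 \<in> nm ` su M"
    then obtain x where x: "x \<in> su M" "rp 1 = nm x" by blast
    \<comment> \<open>Variable 1 cannot be forced equal to x: members of F are large, so some
      assignment would give it both the value x and a value above x.\<close>
    have "F (\<lambda>\<rho>. \<rho> 1 = x)" by (rule F_mono2[OF F_rp[of 1] F_nm[OF x(1)]]) (metis x(2))
    from F_large[OF this] have "slt M x x" unfolding large_def using x(1) by metis
    then show False using lt_irrefl x by blast
  qed
  then have "nm ` su M \<noteq> su K" using rp_in by blast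
  ultimately show ?thesis
    unfolding proper_end_ext_def using nm_inj nm_zero nm_one nm_hom F_nm_lt by auto
qed

lemma M_ISigma_K: "M_ISigma (n + 1) M K nm"
  unfolding M_ISigma_def
proof (intro allI impI ballI)
  fix p x \<sigma> a b
  assume p: "sigma (n + 1) p" and \<sigma>: "env_in K \<sigma>" and a: "a \<in> su M"
    and p0: "sat K (\<sigma>(x := sz K)) p"
    and pS: "\<forall>v\<in>su K. slt K v (nm a) \<longrightarrow> sat K (\<sigma>(x := v)) p \<longrightarrow> sat K (\<sigma>(x := sadd K v (so K))) p"
    and b: "b \<in> su K" "slt K b (nm a)"
  have tr: "sat K (\<sigma>(x := v)) p \<longleftrightarrow> F (\<lambda>\<rho>. sat M ((\<rho> \<circ> \<sigma>)(x := \<rho> v)) p)" if "v \<in> su K" for v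
    unfolding comp_upd by (rule truth) (use p \<sigma> that in auto)
  let ?s = "Var \<circ> \<sigma>"
  obtain y where y: "y \<notin> svars ?s p" using ex_fresh[of "svars ?s p"] by auto
  let ?q = "sub (?s(x := Var y)) p"
  have q: "sat M (\<rho>(y := v)) ?q = sat M ((\<rho> \<circ> \<sigma>)(x := v)) p" for \<rho> v
    unfolding sat_sub sat_sub_bound[OF y] by (simp add: comp_def)
  have Sq: "SgM M (n + 1) ?q" by (intro Sg_sigma sigma_sub p)
  obtain i where i: "m i = a" using m_ex a by blast
  obtain c where c: "c \<in> su M" "slt M c a \<or> c = a"
    "F (\<lambda>\<rho>. \<forall>v\<in>su M. slt M v c \<longrightarrow> sat M ((\<rho> \<circ> \<sigma>)(x := v)) p)"
    "c = a \<or> F (\<lambda>\<rho>. \<not> sat M ((\<rho> \<circ> \<sigma>)(x := c)) p)"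
    using F_ind[OF Sq, of i y] unfolding q i by blast
  have below: "sat K (\<sigma>(x := v)) p" if v: "v \<in> su K" "slt K v (nm c)" for v
    unfolding tr[OF v(1)]
    by (rule F_mono3[OF c(3) v(2)[unfolded slt_K] F_nm[OF c(1)]]) (use E_in in auto)
  \<comment> \<open>If c < a, then p fails in K at the image of c and holds at all smaller elements.
    This contradicts the base case if c = 0, and the induction step at the predecessor of c
    otherwise.\<close>
  have "c = a"
  proof (rule ccontr)
    assume ca: "c \<noteq> a"
    with c have nc: "F (\<lambda>\<rho>. \<not> sat M ((\<rho> \<circ> \<sigma>)(x := c)) p)" and lt: "slt M c a" by blast+
    have "sat K (\<sigma>(x := nm c)) p"
    proof (cases "c = sz M")
      case True
      then show ?thesis using p0 nm_zero by simp
    next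
      case False
      then obtain d where d: "d \<in> su M" "c = sadd M d (so M)" using pred_ex c(1) by blast
      then have "slt M d c" using lt_succ by blast
      then have "slt M d a" using lt_trans[OF d(1) c(1) a] lt by blast
      have "sat K (\<sigma>(x := nm d)) p" using below[of "nm d"] F_nm_lt d(1) c(1) \<open>slt M d c\<close> by simp
      then have "sat K (\<sigma>(x := sadd K (nm d) (so K))) p"
        using pS F_nm_lt d(1) a \<open>slt M d a\<close> by simp
      then show ?thesis using nm_hom(1)[OF d(1) one_closed] nm_one d(2) by simp
    qed
    then have "F (\<lambda>\<rho>. sat M ((\<rho> \<circ> \<sigma>)(x := \<rho> (nm c))) p)" using tr by simp
    then have "F (\<lambda>\<rho>. sat M ((\<rho> \<circ> \<sigma>)(x := c)) p)" by (rule F_mono2[OF _ F_nm[OF c(1)]]) simp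
    then show False using nc F_not_both by blast
  qed
  then show "sat K (\<sigma>(x := b)) p" using below b by simp
qed

lemma good_ext_K: "exp_ax M \<Longrightarrow> good_ext n M K nm"
  using ISigma0_K exp_K proper_end_ext_K sigma_elem_K M_ISigma_K
  by (simp add: good_ext_def IDelta0_exp_def)

end

text \<open>The existence of K has to be stated over a fixed type. The construction from I
  Sigma_{n+2} lives on \<open>nat\<close>, while the converse is proved for structures over any
  type.\<close>

theorem theorem5p11:
  fixes M :: "'a struc" and n :: nat
  assumes "countable (su M)" and "IDelta0_exp M"
  shows "(ISigma (n + 2) M \<longrightarrow>
            (\<exists>(K :: nat struc) e. countable (su K) \<and> good_ext n M K e))
       \<and> ((\<exists>(K :: 'b struc) e. good_ext n M K e) \<longrightarrow> ISigma (n + 2) M)"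
proof (intro conjI impI)
  assume IS: "ISigma (n + 2) M"
  then interpret pa_minus M by (rule ISigma_pa_minus)
  have ne: "su M \<noteq> {}" using zero_closed by blast
  interpret forcing M n "from_nat_into (su M)"
    by unfold_locales (rule range_from_nat_into[OF ne assms(1)], rule IS)
  obtain F where "generic M n (from_nat_into (su M)) F" using generic_filter by blast
  then interpret generic M n "from_nat_into (su M)" F .
  have "good_ext n M K nm" using good_ext_K assms(2) by (simp add: IDelta0_exp_def)
  then show "\<exists>(K :: nat struc) e. countable (su K) \<and> good_ext n M K e"
    using countableI_type by blast
next
  assume "\<exists>(K :: 'b struc) e. good_ext n M K e"
  then show "ISigma (n + 2) M"
    using good_ext_ISigma[of M n] assms(2) unfolding IDelta0_exp_def ISigma_def[of 0] by blast
qed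

end
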